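(* Suppose $\lambda=\mathrm{cf}(\lambda)$ and there is some infinite cardinal $\kappa$ such that $\kappa^+<\lambda<2^\kappa$. Then there is no universal linear order in cardinality $\lambda$.
   Context: A universal linear order in cardinality $\lambda$ is a linear order of cardinality $\lambda$ into which every linear order of cardinality at most $\lambda$ embeds by an order-preserving one-to-one map. *)

theory Defs
  imports Main
begin

unbundle cardinal_syntax

definition order_embedding_on ::
    "('b \<Rightarrow> 'a) \<Rightarrow> 'b set \<Rightarrow> 'b rel \<Rightarrow> 'a set \<Rightarrow> 'a rel \<Rightarrow> bool" where
  "order_embedding_on f B s A r \<longleftrightarrow>
     f ` B \<subseteq> A \<and> inj_on f B \<and>
     (\<forall>x\<in>B. \<forall>y\<in>B. (x, y) \<in> s \<longrightarrow> (f x, f y) \<in> r)"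

(* A definition cannot quantify over the types that carry the linear orders to be embedded.
   The test orders are therefore taken on subsets of the type carrying the cardinal lam.
   Since |Field lam| = lam, every linear order of cardinality at most lam, on any type, is
   isomorphic to one of these; see universal_linear_order_embeds below. *)
definition universal_linear_order :: "'l rel \<Rightarrow> 'a set \<Rightarrow> 'a rel \<Rightarrow> bool" where
  "universal_linear_order lam A r \<longleftrightarrow>
     linear_order_on A r \<and> |A| =o lam \<and>
     (\<forall>(B :: 'l set) s. linear_order_on B s \<and> |B| \<le>o lam \<longrightarrow>
        (\<exists>f. order_embedding_on f B s A r))"

lemma universal_linear_order_embeds:
  fixes lam :: "'l rel" and B :: "'b set" and s :: "'b rel"
  assumes "Card_order lam" and univ: "universal_linear_order lam A r"
    and s: "linear_order_on B s" and "|B| \<le>o lam"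
  shows "\<exists>f. order_embedding_on f B s A r"
proof -
  have "|B| \<le>o |Field lam|"
    by (rule ordLeq_ordIso_trans[OF assms(4) ordIso_symmetric[OF card_of_Field_ordIso[OF assms(1)]]])
  then obtain g where g: "inj_on g B" "g ` B \<subseteq> Field lam"
    by (auto simp: card_of_ordLeq[symmetric])
  define C where "C = g ` B"
  define t where "t = (\<lambda>(x, y). (g x, g y)) ` s"
  have sB: "s \<subseteq> B \<times> B" and "refl_on B s" "trans s" "antisym s" "total_on B s"
    using s unfolding order_on_defs by auto
  have t_iff: "(g x, g y) \<in> t \<longleftrightarrow> (x, y) \<in> s" if "x \<in> B" "y \<in> B" for x y
  proof
    assume "(g x, g y) \<in> t"
    then obtain a b where ab: "(a, b) \<in> s" "g x = g a" "g y = g b"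
      unfolding t_def by auto
    with sB have "a \<in> B" "b \<in> B" by auto
    with ab that have "x = a" "y = b" by (auto dest: inj_onD[OF g(1)])
    with ab show "(x, y) \<in> s" by simp
  qed (force simp: t_def)
  have tC: "t \<subseteq> C \<times> C"
    using sB unfolding t_def C_def by auto
  have "refl_on C t"
    using \<open>refl_on B s\<close> t_iff unfolding refl_on_def C_def by auto
  moreover have "trans t"
  proof (rule transI)
    fix x y z assume *: "(x, y) \<in> t" "(y, z) \<in> t"
    then obtain a b c where "a \<in> B" "b \<in> B" "c \<in> B" "x = g a" "y = g b" "z = g c"
      using tC unfolding C_def by blast
    with * t_iff \<open>trans s\<close> show "(x, z) \<in> t" by (metis transD)
  qed
  moreover have "antisym t"
  proof (rule antisymI)
    fix x y assume *: "(x, y) \<in> t" "(y, x) \<in> t"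
    then obtain a b where "a \<in> B" "b \<in> B" "x = g a" "y = g b"
      using tC unfolding C_def by blast
    with * t_iff \<open>antisym s\<close> show "x = y" by (metis antisymD)
  qed
  moreover have "total_on C t"
    using \<open>total_on B s\<close> t_iff unfolding total_on_def C_def by (metis imageE)
  ultimately have "linear_order_on C t"
    using tC unfolding order_on_defs by blast
  moreover have "|C| \<le>o lam"
    unfolding C_def by (rule ordLeq_transitive[OF card_of_image assms(4)])
  ultimately obtain f where "order_embedding_on f C t A r"
    using univ unfolding universal_linear_order_def by blast
  then have "order_embedding_on (f \<circ> g) B s A r"
    using g(1) t_iff unfolding order_embedding_on_def C_def
    by (auto simp: comp_inj_on image_comp)
  then show ?thesis by blast
qed

end

theory Submission
  imports Defs
begin

text \<open>
  The proof follows the method of Kojman and Shelah. Suppose that \<open>A\<close> is universal, and filter \<open>A\<close>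
  by an enumeration in type \<open>\<lambda>\<close>. A set \<open>a\<close> of ordinals below \<open>\<lambda>\<close> and a point \<open>z\<close> of \<open>A\<close> determine
  a set of bits (\<open>read_bits\<close>): for consecutive \<open>\<alpha>\<close>, \<open>\<beta>\<close>, \<open>\<gamma>\<close> in \<open>a\<close> the bit at the position of \<open>\<alpha>\<close>
  says whether the cut that \<open>z\<close> makes in the points enumerated before \<open>\<beta>\<close> is filled by a point
  enumerated before \<open>\<gamma>\<close>. The same can be done in any order \<open>M\<close> that is filtered by \<open>\<lambda>\<close> many small
  sets. If every cut of \<open>M\<close> has a small cofinality, an embedding of \<open>M\<close> into \<open>A\<close> preserves the
  bits along all \<open>a\<close> that consist of closure points of some function on \<open>\<lambda>\<close>
  (\<open>embedding_preserves_bits\<close>).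

  Suppose that there is a family of only \<open>\<lambda>\<close> many sets \<open>a\<close>, of size at least \<open>\<kappa>\<close>, such that the
  closure points of each function on \<open>\<lambda>\<close> include one of them. Then at most \<open>\<lambda> < 2\<^sup>\<kappa>\<close> sets of bits
  are read off in \<open>A\<close>, and some \<open>X \<subseteq> \<kappa>\<close> is not among them. It remains to construct \<open>M\<close> such that
  for each \<open>a\<close> in the family some point of \<open>M\<close> has exactly the bits \<open>X\<close> along \<open>a\<close>; embedding this
  \<open>M\<close> is then contradictory.

  The points of \<open>M\<close> are words, ordered lexicographically. The word of \<open>a\<close> lists the successors in
  \<open>a\<close> of the points at positions in \<open>X\<close>, and a word with a new letter comes into existence only
  when that letter is reached (\<open>coded_bit\<close>). The letters are ordered like \<open>\<lambda>\<close> many reals, with a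
  dense set of size less than \<open>\<lambda>\<close> (\<open>dense_order\<close>): the dense set separates all continuations of a
  word at once, before they are reached.

  As the stages of \<open>M\<close> must be small, the initial segments of the sets \<open>a\<close> have to be listed
  early. This is why guessing is combined with approachability (\<open>approachable_guessing_exists\<close>).
  On the second successor of \<open>\<kappa>\<close> the guesses are coherent sets of size at most \<open>\<kappa>\<close>, rounded down
  to a fixed set of closure points; the rounding improves with that set and becomes constant in
  fewer than \<open>\<kappa>\<^sup>+\<close> steps (\<open>club_guessing\<close>). For larger \<open>\<lambda>\<close> they are transported along cofinal
  sequences (\<open>approachable_guessing_transport\<close>).
\<close>

section \<open>Well-orders, regular cardinals and closure points\<close>

lemma underS_trans:
  assumes "Well_order r" "x \<in> underS r y" "y \<in> underS r z"
  shows "x \<in> underS r z"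
proof -
  have "trans r" "antisym r"
    using assms(1) by (auto simp: order_on_defs)
  then show ?thesis
    using assms(2,3) unfolding underS_def by (auto dest: transD antisymD)
qed

lemma le_underS_trans:
  assumes "Well_order r" "(x, y) \<in> r" "y \<in> underS r z"
  shows "x \<in> underS r z"
proof -
  have "trans r" "antisym r"
    using assms(1) by (auto simp: order_on_defs)
  then show ?thesis
    using assms(2,3) unfolding underS_def by (auto dest: transD antisymD)
qed

lemma underS_le_trans:
  assumes "Well_order r" "x \<in> underS r y" "(y, z) \<in> r"
  shows "x \<in> underS r z"
proof -
  have "trans r" "antisym r"
    using assms(1) by (auto simp: order_on_defs)
  then show ?thesis
    using assms(2,3) unfolding underS_def by (auto dest: transD antisymD)
qed

lemma le_trans_rel:
  assumes "Well_order r" "(x, y) \<in> r" "(y, z) \<in> r"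
  shows "(x, z) \<in> r"
  using assms by (auto simp: order_on_defs dest: transD)

lemma underS_imp_le: "x \<in> underS r y \<Longrightarrow> (x, y) \<in> r"
  by (simp add: underS_def)

lemma underS_imp_Field: "x \<in> underS r y \<Longrightarrow> x \<in> Field r" "x \<in> underS r y \<Longrightarrow> y \<in> Field r"
  by (auto simp: underS_def Field_def)

lemma underS_irrefl: "x \<notin> underS r x"
  by (simp add: underS_def)

lemma le_refl_Field: "Well_order r \<Longrightarrow> x \<in> Field r \<Longrightarrow> (x, x) \<in> r"
  by (auto simp: order_on_defs refl_on_def)

lemma not_le_iff:
  assumes "Well_order r" "x \<in> Field r" "y \<in> Field r"
  shows "(x, y) \<notin> r \<longleftrightarrow> y \<in> underS r x"
proof -
  have "total_on (Field r) r" "antisym r" "refl_on (Field r) r"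
    using assms(1) by (auto simp: order_on_defs)
  note p = this
  show ?thesis
  proof
    assume n: "(x, y) \<notin> r"
    then have "x \<noteq> y"
      using refl_onD[OF p(3) assms(2)] by auto
    then show "y \<in> underS r x"
      using n p(1) assms(2,3) unfolding underS_def total_on_def by auto
  next
    assume "y \<in> underS r x"
    then show "(x, y) \<notin> r"
      using antisymD[OF p(2)] by (auto simp: underS_def)
  qed
qed

lemma underS_asym: "Well_order r \<Longrightarrow> x \<in> underS r y \<Longrightarrow> y \<notin> underS r x"
  by (metis underS_trans underS_irrefl)

lemma underS_linear:
  assumes "Well_order r" "x \<in> Field r" "y \<in> Field r"
  shows "x \<in> underS r y \<or> x = y \<or> y \<in> underS r x"
  using not_le_iff[OF assms] by (auto simp: underS_def)

lemma underS_directed: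
  assumes "Well_order r" "p \<in> underS r z" "q \<in> underS r z"
  shows "\<exists>w\<in>underS r z. p \<in> under r w \<and> q \<in> under r w"
proof (cases "(p, q) \<in> r")
  case True
  then show ?thesis
    using assms le_refl_Field[OF assms(1)] underS_imp_Field(1)[OF assms(3)]
    by (intro bexI[of _ q]) (auto simp: under_def)
next
  case False
  then have "(q, p) \<in> r"
    using not_le_iff[OF assms(1)] assms(2,3) underS_imp_Field(1) underS_imp_le by metis
  then show ?thesis
    using assms le_refl_Field[OF assms(1)] underS_imp_Field(1)[OF assms(2)]
    by (intro bexI[of _ p]) (auto simp: under_def)
qed

lemma least_exists:
  assumes "Well_order r" "S \<subseteq> Field r" "S \<noteq> {}"
  obtains m where "m \<in> S" "\<And>x. x \<in> S \<Longrightarrow> (m, x) \<in> r"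
proof -
  interpret wo_rel r
    using assms(1) by (simp add: wo_rel_def)
  show ?thesis
    using that[of "minim S"] minim_in[OF assms(2,3)] minim_least[OF assms(2)] by blast
qed

abbreviation lub :: "'a rel \<Rightarrow> 'a set \<Rightarrow> 'a" where
  "lub r X \<equiv> wo_rel.supr r X"

lemma lub_props:
  assumes "Well_order r" "X \<subseteq> Field r" "u \<in> Field r" "\<And>x. x \<in> X \<Longrightarrow> (x, u) \<in> r"
  shows lub_Field: "lub r X \<in> Field r"
    and lub_upper: "x \<in> X \<Longrightarrow> (x, lub r X) \<in> r"
    and lub_least: "(lub r X, u) \<in> r"
    and less_lub: "y \<in> underS r (lub r X) \<Longrightarrow> \<exists>x\<in>X. y \<in> underS r x"
proof -
  have W: "wo_rel r"
    using assms(1) by (simp add: wo_rel_def)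
  have ne: "Above r X \<noteq> {}" and sub: "Above r X \<subseteq> Field r" and u: "u \<in> Above r X"
    using assms(3,4) by (auto simp: Above_def)
  have m: "lub r X \<in> Above r X"
    unfolding wo_rel.supr_def[OF W] by (rule wo_rel.minim_in[OF W sub ne])
  then show F: "lub r X \<in> Field r" and "x \<in> X \<Longrightarrow> (x, lub r X) \<in> r"
    by (auto simp: Above_def)
  show "(lub r X, u) \<in> r"
    unfolding wo_rel.supr_def[OF W] by (rule wo_rel.minim_least[OF W sub u])
  show "\<exists>x\<in>X. y \<in> underS r x" if y: "y \<in> underS r (lub r X)"
  proof (rule ccontr)
    assume c: "\<not> ?thesis"
    have yF: "y \<in> Field r"
      using underS_imp_Field[OF y] by blast
    have "(x, y) \<in> r" if "x \<in> X" for x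
      using not_le_iff[OF assms(1), of x y] c that yF assms(2) by blast
    then have "y \<in> Above r X"
      using yF by (auto simp: Above_def)
    then have "(lub r X, y) \<in> r"
      unfolding wo_rel.supr_def[OF W] by (rule wo_rel.minim_least[OF W sub])
    then show False
      using y not_le_iff[OF assms(1) F yF] by blast
  qed
qed

text \<open>
  Closed unbounded sets enter only as sets of closure points of functions. Such a set is closed
  under suprema, it is unbounded below an uncountable regular cardinal, and a function that bounds
  a family of functions pointwise has its closure points in the intersection of theirs.
\<close>

definition closure_points :: "'a rel \<Rightarrow> ('a \<Rightarrow> 'a) \<Rightarrow> 'a set" where
  "closure_points r G = {b \<in> Field r. G ` underS r b \<subseteq> underS r b}"

lemma closure_pointsI:
  "b \<in> Field r \<Longrightarrow> (\<And>x. x \<in> underS r b \<Longrightarrow> G x \<in> underS r b) \<Longrightarrow> b \<in> closure_points r G"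
  by (auto simp: closure_points_def)

lemma closure_pointsD:
  "b \<in> closure_points r G \<Longrightarrow> x \<in> underS r b \<Longrightarrow> G x \<in> underS r b"
  "b \<in> closure_points r G \<Longrightarrow> b \<in> Field r"
  by (auto simp: closure_points_def)

lemma lub_closure_points:
  assumes wo: "Well_order r" and X: "X \<subseteq> closure_points r G" and u: "u \<in> Field r"
    and "\<And>x. x \<in> X \<Longrightarrow> (x, u) \<in> r"
  shows "lub r X \<in> closure_points r G"
proof (rule closure_pointsI)
  have XF: "X \<subseteq> Field r"
    using X by (auto simp: closure_points_def)
  show "lub r X \<in> Field r"
    by (rule lub_Field[OF wo XF u assms(4)])
  fix y assume "y \<in> underS r (lub r X)"
  then obtain x where x: "x \<in> X" "y \<in> underS r x"
    using less_lub[OF wo XF u assms(4)] by blast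
  then have "G y \<in> underS r x"
    using closure_pointsD(1)[of x r G] X by auto
  then show "G y \<in> underS r (lub r X)"
    using underS_le_trans[OF wo _ lub_upper[OF wo XF u assms(4) x(1)]] by blast
qed

lemma closure_points_anti:
  assumes "Well_order r" "\<And>x. x \<in> Field r \<Longrightarrow> (G x, H x) \<in> r"
  shows "closure_points r H \<subseteq> closure_points r G"
proof
  fix b assume b: "b \<in> closure_points r H"
  show "b \<in> closure_points r G"
  proof (rule closure_pointsI)
    show "b \<in> Field r"
      using closure_pointsD(2)[OF b] .
    fix x assume "x \<in> underS r b"
    then have "x \<in> Field r" "H x \<in> underS r b"
      using closure_pointsD(1)[OF b] by (auto simp: underS_imp_Field)
    then show "G x \<in> underS r b"
      using le_underS_trans[OF assms(1) assms(2)] by simp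
  qed
qed

locale uncountable_regular =
  fixes r :: "'a rel"
  assumes card: "Card_order r" and reg: "regularCard r" and unc: "natLeq <o r"
begin

lemma wo: "Well_order r"
  using card by (rule card_order_on_well_order_on)

lemma Cinf: "Cinfinite r"
  using unc card natLeq_ordLeq_cinfinite by (metis cinfinite_mono natLeq_cinfinite ordLess_imp_ordLeq)

lemma inf: "infinite (Field r)"
  using Cinf by (simp add: cinfinite_def)

lemma small_subset: "|A| <o r \<Longrightarrow> B \<subseteq> A \<Longrightarrow> |B| <o r"
  using card_of_mono1 ordLeq_ordLess_trans by blast

lemma small_image: "|A| <o r \<Longrightarrow> |f ` A| <o r"
  using card_of_image ordLeq_ordLess_trans by blast

lemma small_UN: "|I| <o r \<Longrightarrow> (\<And>i. i \<in> I \<Longrightarrow> |A i| <o r) \<Longrightarrow> |\<Union>i\<in>I. A i| <o r"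
  using card_of_UNION_ordLess_infinite_Field_regularCard[OF reg Cinf] by blast

lemma small_Times: "|A| <o r \<Longrightarrow> |B| <o r \<Longrightarrow> |A \<times> B| <o r"
proof -
  assume A: "|A| <o r" and B: "|B| <o r"
  have "A \<times> B = (\<Union>a\<in>A. Pair a ` B)"
    by auto
  show ?thesis
    unfolding \<open>A \<times> B = _\<close> by (rule small_UN[OF A small_image[OF B]])
qed

lemma small_finite: "finite A \<Longrightarrow> |A| <o r"
  by (rule finite_ordLess_infinite[OF card_of_Well_order wo _ inf]) (simp add: Field_card_of)

lemma small_Un: "|A| <o r \<Longrightarrow> |B| <o r \<Longrightarrow> |A \<union> B| <o r"
  using card_of_Un_ordLess_infinite_Field[OF inf card] .

lemma small_insert: "|A| <o r \<Longrightarrow> |insert x A| <o r"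
  using small_Un[of "{x}" A] small_finite[of "{x}"] by simp

lemma small_underS: "|underS r x| <o r"
proof (cases "x \<in> Field r")
  case False
  then have "underS r x = {}"
    by (auto simp: underS_def Field_def)
  then show ?thesis
    by (simp add: small_finite)
qed (rule card_of_underS[OF card])

lemma under_eq: "x \<in> Field r \<Longrightarrow> under r x = insert x (underS r x)"
  using le_refl_Field[OF wo] by (auto simp: under_def underS_def)

lemma small_under: "|under r x| <o r"
proof (cases "x \<in> Field r")
  case False
  then have "under r x = {}"
    by (auto simp: under_def Field_def)
  then show ?thesis
    by (simp add: small_finite)
qed (simp add: under_eq small_insert small_underS)

lemma small_bounded:
  assumes "X \<subseteq> Field r" "|X| <o r"
  obtains u where "u \<in> Field r" "X \<subseteq> underS r u"
proof -
  have "\<not> cofinal X r"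
    using reg assms not_ordLess_ordIso unfolding regularCard_def by blast
  then obtain a where a: "a \<in> Field r" "\<And>b. b \<in> X \<Longrightarrow> \<not> (a \<noteq> b \<and> (a, b) \<in> r)"
    unfolding cofinal_def by blast
  obtain u where u: "u \<in> Field r" "a \<noteq> u" "(a, u) \<in> r"
    using infinite_Card_order_limit[OF card inf a(1)] by blast
  have "X \<subseteq> underS r u"
  proof
    fix x assume x: "x \<in> X"
    then have "(x, a) \<in> r"
      using a underS_linear[OF wo a(1), of x] le_refl_Field[OF wo a(1)] assms(1)
      by (auto simp: underS_def)
    then show "x \<in> underS r u"
      using le_underS_trans[OF wo] u by (auto simp: underS_def)
  qed
  then show ?thesis
    using that u(1) by blast
qed

lemma small_bounded_above:
  assumes "X \<subseteq> Field r" "|X| <o r" "y \<in> Field r"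
  obtains u where "u \<in> Field r" "X \<subseteq> underS r u" "y \<in> underS r u"
proof -
  have "insert y X \<subseteq> Field r" "|insert y X| <o r"
    using assms small_insert by auto
  then obtain u where "u \<in> Field r" "insert y X \<subseteq> underS r u"
    by (rule small_bounded)
  then show ?thesis
    using that by blast
qed

lemma small_countable: "|range (f :: nat \<Rightarrow> 'b)| <o r"
proof -
  have "|range f| \<le>o |UNIV :: nat set|"
    by (rule card_of_image)
  also have "|UNIV :: nat set| =o natLeq"
    by (rule card_of_nat)
  finally show ?thesis
    using unc ordLeq_ordLess_trans by blast
qed

text \<open>
  The supremum of \<open>\<omega>\<close> iterations of \<open>G\<close> is closed under \<open>G\<close>; it exists because \<open>r\<close> has uncountable
  cofinality.
\<close>

lemma closure_points_unbounded:
  assumes G: "\<And>x. x \<in> Field r \<Longrightarrow> G x \<in> Field r" and x: "x \<in> Field r"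
  obtains b where "b \<in> closure_points r G" "x \<in> underS r b"
proof -
  have ex: "\<exists>u. u \<in> Field r \<and> y \<in> underS r u \<and> G ` under r y \<subseteq> underS r u" if "y \<in> Field r" for y
  proof -
    have "G ` under r y \<subseteq> Field r"
      using G by (auto simp: under_def Field_def)
    then show ?thesis
      using small_bounded_above[OF _ small_image[OF small_under] that] by metis
  qed
  define nx where "nx y = (SOME u. u \<in> Field r \<and> y \<in> underS r u \<and> G ` under r y \<subseteq> underS r u)" for y
  have nx: "nx y \<in> Field r" "y \<in> underS r (nx y)" "G ` under r y \<subseteq> underS r (nx y)" if "y \<in> Field r" for y
    using someI_ex[OF ex[OF that]] unfolding nx_def by blast+
  define s where "s n = (nx ^^ n) x" for n
  have sF: "s n \<in> Field r" for n
    by (induction n) (auto simp: s_def x nx)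
  have s_Suc: "s (Suc n) = nx (s n)" for n
    by (simp add: s_def)
  obtain u where u: "u \<in> Field r" "range s \<subseteq> underS r u"
    using small_bounded[of "range s"] small_countable sF by auto
  have rF: "range s \<subseteq> Field r" and ub: "\<And>n. (s n, u) \<in> r"
    using sF u(2) by (auto simp: underS_def)
  define b where "b = lub r (range s)"
  have sb: "(s n, b) \<in> r" for n
    unfolding b_def using lub_upper[OF wo rF u(1)] ub by blast
  have lb: "\<exists>n. y \<in> underS r (s n)" if "y \<in> underS r b" for y
    using less_lub[OF wo rF u(1)] ub that unfolding b_def by blast
  have "b \<in> closure_points r G"
  proof (rule closure_pointsI)
    show "b \<in> Field r"
      using sb[of 0] by (auto simp: Field_def)
    fix y assume "y \<in> underS r b"
    then obtain n where "y \<in> underS r (s n)"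
      using lb by blast
    then have "G y \<in> underS r (s (Suc n))"
      using nx(3)[OF sF[of n]] s_Suc by (auto simp: under_def underS_def)
    then show "G y \<in> underS r b"
      using underS_le_trans[OF wo] sb by blast
  qed
  moreover have "x \<in> underS r b"
    using underS_le_trans[OF wo nx(2)[OF x]] sb[of 1] by (simp add: s_def)
  ultimately show ?thesis
    using that by blast
qed

text \<open>
  Together with \<open>closure_points_anti\<close> this intersects fewer than \<open>r\<close> sets of closure points.
\<close>

lemma common_bound:
  assumes "|I| <o r" and "\<And>i x. i \<in> I \<Longrightarrow> x \<in> Field r \<Longrightarrow> G i x \<in> Field r"
  obtains H where "\<And>x. x \<in> Field r \<Longrightarrow> H x \<in> Field r"
    and "\<And>i x. i \<in> I \<Longrightarrow> x \<in> Field r \<Longrightarrow> G i x \<in> underS r (H x)"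
proof -
  have "\<exists>u. x \<in> Field r \<longrightarrow> u \<in> Field r \<and> (\<lambda>i. G i x) ` I \<subseteq> underS r u" for x
  proof (cases "x \<in> Field r")
    case True
    then have "(\<lambda>i. G i x) ` I \<subseteq> Field r"
      using assms(2) by blast
    then show ?thesis
      using small_bounded[OF _ small_image[OF assms(1)]] by metis
  qed simp
  then obtain H where "\<forall>x. x \<in> Field r \<longrightarrow> H x \<in> Field r \<and> (\<lambda>i. G i x) ` I \<subseteq> underS r (H x)"
    by metis
  then show ?thesis
    using that[of H] by blast
qed

end

section \<open>Club guessing\<close>

definition floor_in :: "'a rel \<Rightarrow> 'a set \<Rightarrow> 'a \<Rightarrow> 'a" where
  "floor_in r E x = lub r (E \<inter> under r x)"

lemma floor_in_closure_points:
  fixes G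
  assumes wo: "Well_order r" and x: "x \<in> Field r"
  defines "E \<equiv> closure_points r G"
  shows floor_in_mem: "floor_in r E x \<in> E"
    and floor_in_le: "(floor_in r E x, x) \<in> r"
    and floor_in_greatest: "e \<in> E \<Longrightarrow> (e, x) \<in> r \<Longrightarrow> (e, floor_in r E x) \<in> r"
    and floor_in_fix: "x \<in> E \<Longrightarrow> floor_in r E x = x"
proof -
  have sub: "E \<inter> under r x \<subseteq> Field r" and ub: "y \<in> E \<inter> under r x \<Longrightarrow> (y, x) \<in> r" for y
    by (auto simp: under_def Field_def)
  show "floor_in r E x \<in> E"
    unfolding floor_in_def E_def
    by (rule lub_closure_points[OF wo _ x]) (auto simp: under_def)
  show le: "(floor_in r E x, x) \<in> r"
    unfolding floor_in_def by (rule lub_least[OF wo sub x ub])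
  show gr: "e \<in> E \<Longrightarrow> (e, x) \<in> r \<Longrightarrow> (e, floor_in r E x) \<in> r" for e
    unfolding floor_in_def by (rule lub_upper[OF wo sub x ub]) (auto simp: under_def)
  have "antisym r"
    using wo by (simp add: order_on_defs)
  then show "x \<in> E \<Longrightarrow> floor_in r E x = x"
    using gr[OF _ le_refl_Field[OF wo x]] le by (auto dest: antisymD)
qed

lemma floor_in_mono:
  assumes "Well_order r" "x \<in> Field r" "closure_points r G \<subseteq> closure_points r H"
  shows "(floor_in r (closure_points r G) x, floor_in r (closure_points r H) x) \<in> r"
  by (rule floor_in_greatest[OF assms(1,2) subsetD[OF assms(3) floor_in_mem[OF assms(1,2)]]
        floor_in_le[OF assms(1,2)]])

text \<open>
  Rounding a point down to smaller and smaller sets of closure points can only lower it, and in a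
  well-order this happens finitely often. Hence along a decreasing sequence of length \<open>sg\<close> a piece
  with fewer than \<open>sg\<close> points becomes constant before the end. If no stage guessed every set of
  closure points, then each stage could be followed by one that moves a point of every piece whose
  rounding has size at least \<open>k\<close>, and the piece provided for the intersection of all stages would
  never become constant.
\<close>

lemma club_guessing:
  fixes k :: "'k rel" and piece :: "'i \<Rightarrow> 'a set"
  assumes r: "uncountable_regular r" and sg: "uncountable_regular sg" and less: "sg <o r"
    and small: "\<And>i. i \<in> I \<Longrightarrow> |piece i| <o sg" and sub: "\<And>i. i \<in> I \<Longrightarrow> piece i \<subseteq> Field r"
    and large: "\<And>G. (\<And>x. x \<in> Field r \<Longrightarrow> G x \<in> Field r) \<Longrightarrow>
        \<exists>i\<in>I. k \<le>o |closure_points r G \<inter> piece i|"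
  shows "\<exists>H. (\<forall>x\<in>Field r. H x \<in> Field r) \<and>
    (\<forall>G. (\<forall>x\<in>Field r. G x \<in> Field r) \<longrightarrow>
      (\<exists>i\<in>I. k \<le>o |floor_in r (closure_points r H) ` piece i| \<and>
         floor_in r (closure_points r H) ` piece i \<subseteq> closure_points r G))"
proof (rule ccontr)
  interpret r: uncountable_regular r by (rule r)
  interpret sg: uncountable_regular sg by (rule sg)
  let ?C = "closure_points r"
  let ?fl = "\<lambda>H. floor_in r (?C H)"
  define F where "F G \<longleftrightarrow> (\<forall>x\<in>Field r. G x \<in> Field r)" for G
  define big where "big H i \<longleftrightarrow> k \<le>o |?fl H ` piece i|" for H i
  define inside where "inside H i G \<longleftrightarrow> ?fl H ` piece i \<subseteq> ?C G" for H i G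
  assume "\<not> ?thesis"
  then have neg: "\<not> (\<exists>H. F H \<and> (\<forall>G. F G \<longrightarrow> (\<exists>i\<in>I. big H i \<and> inside H i G)))"
    unfolding F_def big_def inside_def .
  have "\<exists>G. F H \<longrightarrow> F G \<and> (\<forall>i\<in>I. big H i \<longrightarrow> \<not> inside H i G)" for H
  proof (cases "F H")
    case True
    then have "\<not> (\<forall>G. F G \<longrightarrow> (\<exists>i\<in>I. big H i \<and> inside H i G))"
      using neg by (metis (no_types))
    then show ?thesis
      by (metis (no_types))
  qed simp
  then obtain D where D: "\<And>H. F H \<Longrightarrow> F (D H)"
    and bad: "\<And>H i. F H \<Longrightarrow> i \<in> I \<Longrightarrow> big H i \<Longrightarrow> \<not> inside H i (D H)"
    by (metis (no_types))
  have FD: "G x \<in> Field r" if "F G" "x \<in> Field r" for G x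
    using that by (simp add: F_def)
  \<comment> \<open>The next set of closure points lies in all previous ones and in their counterexamples.\<close>
  define P where "P f z H \<longleftrightarrow> F H \<and>
    (\<forall>z'\<in>underS sg z. \<forall>x\<in>Field r. (f z' x, H x) \<in> r \<and> (D (f z') x, H x) \<in> r)" for f z and H :: "'a \<Rightarrow> 'a"
  have "\<exists>f. \<forall>z. P f z (f z)"
  proof (rule dependent_wf_choice)
    show "wf (sg - Id)"
      using sg.wo by (simp add: well_order_on_def)
    show "P f z H = P g z H" if "\<And>y. (y, z) \<in> sg - Id \<Longrightarrow> f y = g y" for f g z H
      using that unfolding P_def underS_def by auto
    fix z f assume IH: "\<And>y. (y, z) \<in> sg - Id \<Longrightarrow> P f y (f y)"
    have IHF: "F (f y)" if "y \<in> underS sg z" for y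
      using IH[of y] that by (auto simp: P_def underS_def)
    define GG where "GG = (\<lambda>(y, b). if b then f y else D (f y))"
    have c1: "|underS sg z \<times> (UNIV :: bool set)| <o r"
      by (rule r.small_Times[OF ordLess_transitive[OF sg.small_underS less] r.small_finite]) simp
    have c2: "GG i x \<in> Field r" if "i \<in> underS sg z \<times> UNIV" "x \<in> Field r" for i x
      using that FD[OF IHF] FD[OF D[OF IHF]] unfolding GG_def by (auto split: prod.splits)
    obtain H where H: "\<And>x. x \<in> Field r \<Longrightarrow> H x \<in> Field r"
      and bd: "\<And>i x. i \<in> underS sg z \<times> UNIV \<Longrightarrow> x \<in> Field r \<Longrightarrow> GG i x \<in> underS r (H x)"
      by (rule r.common_bound[OF c1 c2], assumption, assumption, rule that)
    have "P f z H"
      unfolding P_def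
    proof (intro conjI ballI)
      show "F H"
        using H by (simp add: F_def)
      fix z' x assume z': "z' \<in> underS sg z" and x: "x \<in> Field r"
      show "(f z' x, H x) \<in> r"
        using bd[of "(z', True)" x] z' x by (simp add: GG_def underS_def)
      show "(D (f z') x, H x) \<in> r"
        using bd[of "(z', False)" x] z' x by (simp add: GG_def underS_def)
    qed
    then show "\<exists>H. P f z H"
      by (rule exI[of _ H])
  qed
  then obtain f where f: "\<And>z. P f z (f z)"
    by (elim exE) (rule that, erule spec)
  have fF: "F (f z)" for z
    using f[of z] by (simp add: P_def)
  have dec: "?C (f z) \<subseteq> ?C (f z')" "?C (f z) \<subseteq> ?C (D (f z'))" if "z' \<in> underS sg z" for z z'
    by (rule closure_points_anti[OF r.wo], use f[of z] that in \<open>simp add: P_def\<close>)+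
  have c1: "|Field sg| <o r"
    by (rule ordIso_ordLess_trans[OF card_of_Field_ordIso[OF sg.card] less])
  obtain h where h: "\<And>x. x \<in> Field r \<Longrightarrow> h x \<in> Field r"
    and bd: "\<And>z x. z \<in> Field sg \<Longrightarrow> x \<in> Field r \<Longrightarrow> f z x \<in> underS r (h x)"
    by (rule r.common_bound[OF c1 FD[OF fF]], assumption, rule that)
  have hsub: "?C h \<subseteq> ?C (f z)" if "z \<in> Field sg" for z
    using bd[OF that] by (intro closure_points_anti[OF r.wo]) (auto simp: underS_def)
  \<comment> \<open>The points of the piece that survive all stages are fixed by every rounding, so the piece
    stays large.\<close>
  obtain i where i: "i \<in> I" "k \<le>o |?C h \<inter> piece i|"
    using large[of h, OF h] by auto
  have large': "big (f z) i" if "z \<in> Field sg" for z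
  proof -
    have "?C h \<inter> piece i \<subseteq> ?fl (f z) ` piece i"
    proof
      fix x assume x: "x \<in> ?C h \<inter> piece i"
      then have "?fl (f z) x = x"
        using hsub[OF that] sub[OF i(1)] by (intro floor_in_fix[OF r.wo]) auto
      then show "x \<in> ?fl (f z) ` piece i"
        using x by (metis IntD2 image_eqI)
    qed
    then show ?thesis
      unfolding big_def by (rule ordLeq_transitive[OF i(2) card_of_mono1])
  qed
  \<comment> \<open>The value of the rounding at \<open>x\<close> is least, and constant from then on, at the stage \<open>s x\<close>.\<close>
  have "\<exists>z. z \<in> Field sg \<and> (\<forall>z'\<in>Field sg. (?fl (f z) x, ?fl (f z') x) \<in> r)" if "x \<in> Field r" for x
  proof -
    have "(\<lambda>z. ?fl (f z) x) ` Field sg \<subseteq> Field r"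
      using floor_in_le[OF r.wo that] by (auto simp: Field_def)
    moreover have "(\<lambda>z. ?fl (f z) x) ` Field sg \<noteq> {}"
      using sg.inf by auto
    ultimately obtain m where "m \<in> (\<lambda>z. ?fl (f z) x) ` Field sg"
      "\<And>y. y \<in> (\<lambda>z. ?fl (f z) x) ` Field sg \<Longrightarrow> (m, y) \<in> r"
      by (rule least_exists[OF r.wo]) blast
    then show ?thesis
      by blast
  qed
  then have "\<forall>x. \<exists>z. x \<in> Field r \<longrightarrow> z \<in> Field sg \<and> (\<forall>z'\<in>Field sg. (?fl (f z) x, ?fl (f z') x) \<in> r)"
    by blast
  then obtain s where s: "\<And>x. x \<in> Field r \<Longrightarrow> s x \<in> Field sg"
    and smin: "\<And>x z. x \<in> Field r \<Longrightarrow> z \<in> Field sg \<Longrightarrow> (?fl (f (s x)) x, ?fl (f z) x) \<in> r"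
    by metis
  have "s ` piece i \<subseteq> Field sg"
    using s sub[OF i(1)] by blast
  then obtain z where z: "z \<in> Field sg" "s ` piece i \<subseteq> underS sg z"
    by (rule sg.small_bounded[OF _ sg.small_image[OF small[OF i(1)]]])
  obtain x where x: "x \<in> piece i" "?fl (f z) x \<notin> ?C (D (f z))"
    using bad[OF fF i(1) large'[OF z(1)]] unfolding inside_def by auto
  have xF: "x \<in> Field r"
    using sub[OF i(1)] x by blast
  obtain w where w: "w \<in> Field sg" "z \<in> underS sg w"
    using infinite_Card_order_limit[OF sg.card sg.inf z(1)] by (auto simp: underS_def)
  have "?fl (f w) x \<noteq> ?fl (f z) x"
    using floor_in_mem[OF r.wo xF, of "f w"] dec(2)[OF w(2)] x(2) by auto
  moreover have "(?fl (f w) x, ?fl (f z) x) \<in> r"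
    by (rule floor_in_mono[OF r.wo xF dec(1)[OF w(2)]])
  moreover have "(?fl (f z) x, ?fl (f (s x)) x) \<in> r"
    using z(2) x(1) by (intro floor_in_mono[OF r.wo xF dec(1)]) auto
  moreover have "(?fl (f (s x)) x, ?fl (f w) x) \<in> r"
    by (rule smin[OF xF w(1)])
  moreover have "antisym r"
    using r.wo by (simp add: order_on_defs)
  ultimately show False
    using le_trans_rel[OF r.wo] by (metis antisymD)
qed

section \<open>Approachable guessing families\<close>

text \<open>
  The members of the sets \<open>BB h\<close> guess sets of closure points as in club guessing. In addition the
  initial segments of a guess are approachable: the part of \<open>a\<close> below \<open>x\<close> is listed at a stage
  before the next point of \<open>a\<close>. As each stage lists fewer than \<open>r\<close> sets, only few initial segments
  have to be taken care of at each stage of a construction along \<open>r\<close>, although there may be \<open>r\<close>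
  many guesses.
\<close>

definition approachable_guessing :: "'k rel \<Rightarrow> 'a rel \<Rightarrow> ('a \<Rightarrow> 'a set set) \<Rightarrow> bool" where
  "approachable_guessing k r BB \<longleftrightarrow>
     (\<forall>h\<in>Field r. |BB h| <o r) \<and>
     (\<forall>G. (\<forall>x\<in>Field r. G x \<in> Field r) \<longrightarrow>
       (\<exists>h\<in>Field r. \<exists>a\<in>BB h. a \<subseteq> closure_points r G \<and> k \<le>o |a| \<and> |a| <o r \<and>
         (\<forall>x\<in>a. \<forall>y\<in>a. x \<in> underS r y \<longrightarrow> (\<exists>h\<in>underS r y. a \<inter> underS r x \<in> BB h))))"

context uncountable_regular
begin

lemma closure_points_large:
  assumes "\<And>x. x \<in> Field r \<Longrightarrow> G x \<in> Field r" and k: "Card_order k" "k <o r"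
  obtains X where "X \<subseteq> closure_points r G" "|X| =o k"
proof -
  let ?E = "closure_points r G"
  have sub: "?E \<subseteq> Field r"
    by (auto simp: closure_points_def)
  have "\<not> |?E| <o r"
  proof
    assume "|?E| <o r"
    then obtain u where u: "u \<in> Field r" "?E \<subseteq> underS r u"
      by (rule small_bounded[OF sub])
    obtain b where "b \<in> ?E" "u \<in> underS r b"
      by (rule closure_points_unbounded[OF assms(1) u(1)])
    then show False
      using u(2) underS_asym[OF wo] by blast
  qed
  then have "r \<le>o |?E|"
    using not_ordLess_iff_ordLeq[OF wo card_of_Well_order, of ?E]
      ordLess_or_ordLeq[OF card_of_Well_order wo] by blast
  then have "|Field k| \<le>o |?E|"
    using k by (meson card_of_Field_ordIso ordIso_ordLeq_trans ordLess_imp_ordLeq ordLeq_transitive)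
  then obtain f where f: "inj_on f (Field k)" "f ` Field k \<subseteq> ?E"
    unfolding card_of_ordLeq[symmetric] by blast
  have "|f ` Field k| =o |Field k|"
    using f(1) card_of_ordIsoI[OF inj_on_imp_bij_betw] ordIso_symmetric by blast
  then show ?thesis
    using that[OF f(2)] ordIso_transitive[OF _ card_of_Field_ordIso[OF k(1)]] by blast
qed

end

text \<open>
  Every \<open>d\<close> in \<open>Field r\<close> is the increasing union of the sets of those points below \<open>d\<close> whose
  index, under a fixed injection into \<open>sg\<close>, is less than \<open>z\<close>. For \<open>g\<close> below \<open>d\<close> this filtration
  and that of \<open>g\<close> itself agree below \<open>g\<close> at closure points \<open>z\<close> of the translations between the two
  indexings. Closing off under the translations for all \<open>g\<close> in the piece at once makes it
  coherent.
\<close>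

lemma coherent_pieces:
  fixes sg :: "'b rel"
  assumes r: "uncountable_regular r" and sg: "uncountable_regular sg"
    and below: "\<And>x. x \<in> Field r \<Longrightarrow> |underS r x| \<le>o sg"
  obtains piece :: "'a \<Rightarrow> 'b \<Rightarrow> 'a set"
  where "\<And>d z. d \<in> Field r \<Longrightarrow> piece d z \<subseteq> underS r d"
    and "\<And>d z. d \<in> Field r \<Longrightarrow> |piece d z| <o sg"
    and "\<And>d X. d \<in> Field r \<Longrightarrow> X \<subseteq> underS r d \<Longrightarrow> |X| <o sg \<Longrightarrow>
      \<exists>z\<in>Field sg. X \<subseteq> piece d z \<and> (\<forall>g\<in>piece d z. piece d z \<inter> underS r g = piece g z)"
proof -
  interpret r: uncountable_regular r by (rule r)
  interpret sg: uncountable_regular sg by (rule sg)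
  have "\<exists>f. d \<in> Field r \<longrightarrow> inj_on f (underS r d) \<and> f ` underS r d \<subseteq> Field sg" for d
    using ordLeq_ordIso_trans[OF below ordIso_symmetric[OF card_of_Field_ordIso[OF sg.card]], of d]
    unfolding card_of_ordLeq[symmetric] by blast
  then obtain i where i: "\<And>d. d \<in> Field r \<Longrightarrow> inj_on (i d) (underS r d)"
    and iF: "\<And>d. d \<in> Field r \<Longrightarrow> i d ` underS r d \<subseteq> Field sg"
    by metis
  define piece where "piece d z = {x \<in> underS r d. i d x \<in> underS sg z}" for d z
  have p_sub: "piece d z \<subseteq> underS r d" for d z
    by (auto simp: piece_def)
  have p_small: "|piece d z| <o sg" if "d \<in> Field r" for d z
  proof -
    have "|piece d z| \<le>o |underS sg z|"
      by (rule card_of_ordLeqI[of "i d"])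
        (use inj_on_subset[OF i[OF that] p_sub] in \<open>auto simp: piece_def\<close>)
    then show ?thesis
      by (rule ordLeq_ordLess_trans[OF _ sg.small_underS])
  qed
  have good: "\<exists>z\<in>Field sg. X \<subseteq> piece d z \<and> (\<forall>g\<in>piece d z. piece d z \<inter> underS r g = piece g z)"
    if d: "d \<in> Field r" and X: "X \<subseteq> underS r d" "|X| <o sg" for d X
  proof -
    define Z1 where "Z1 z = {i g x | g x. g \<in> underS r d \<and> x \<in> underS r g \<and>
      i d g \<in> under sg z \<and> i d x \<in> under sg z}" for z
    define Z2 where "Z2 z = {i d x | g x. g \<in> underS r d \<and> x \<in> underS r g \<and>
      i d g \<in> under sg z \<and> i g x \<in> under sg z}" for z
    define v where "v g = inv_into (underS r g) (i g)" for g
    have v: "v g (i g x) = x" if "g \<in> Field r" "x \<in> underS r g" for g x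
      unfolding v_def using inv_into_f_f[OF i[OF that(1)] that(2)] .
    have "Z1 z \<subseteq> (\<lambda>(a, b). i (v d a) (v d b)) ` (under sg z \<times> under sg z)" for z
    proof
      fix y assume "y \<in> Z1 z"
      then obtain g x where gx: "y = i g x" "g \<in> underS r d" "x \<in> underS r g"
        "i d g \<in> under sg z" "i d x \<in> under sg z"
        unfolding Z1_def by blast
      have "y = (\<lambda>(a, b). i (v d a) (v d b)) (i d g, i d x)"
        using gx v[OF d gx(2)] v[OF d underS_trans[OF r.wo gx(3,2)]] by simp
      then show "y \<in> (\<lambda>(a, b). i (v d a) (v d b)) ` (under sg z \<times> under sg z)"
        using gx by blast
    qed
    then have s1: "|Z1 z| <o sg" for z
      by (rule sg.small_subset[OF sg.small_image[OF sg.small_Times[OF sg.small_under sg.small_under]]])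
    have "Z2 z \<subseteq> (\<lambda>(a, b). i d (v (v d a) b)) ` (under sg z \<times> under sg z)" for z
    proof
      fix y assume "y \<in> Z2 z"
      then obtain g x where gx: "y = i d x" "g \<in> underS r d" "x \<in> underS r g"
        "i d g \<in> under sg z" "i g x \<in> under sg z"
        unfolding Z2_def by blast
      have "y = (\<lambda>(a, b). i d (v (v d a) b)) (i d g, i g x)"
        using gx v[OF d gx(2)] v[OF underS_imp_Field(1)[OF gx(2)] gx(3)] by simp
      then show "y \<in> (\<lambda>(a, b). i d (v (v d a) b)) ` (under sg z \<times> under sg z)"
        using gx by blast
    qed
    then have s2: "|Z2 z| <o sg" for z
      by (rule sg.small_subset[OF sg.small_image[OF sg.small_Times[OF sg.small_under sg.small_under]]])
    have ZF: "Z1 z \<union> Z2 z \<subseteq> Field sg" for z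
    proof -
      have "i g x \<in> Field sg" "i d x \<in> Field sg" if "g \<in> underS r d" "x \<in> underS r g" for g x
        using iF[OF underS_imp_Field(1)[OF that(1)]] iF[OF d] that underS_trans[OF r.wo that(2,1)]
        by auto
      then show ?thesis
        unfolding Z1_def Z2_def by blast
    qed
    have "\<exists>u. u \<in> Field sg \<and> Z1 z \<union> Z2 z \<subseteq> underS sg u" for z
      using sg.small_bounded[OF ZF sg.small_Un[OF s1 s2]] by metis
    then obtain G where G: "\<And>z. G z \<in> Field sg" "\<And>z. Z1 z \<union> Z2 z \<subseteq> underS sg (G z)"
      by metis
    have XF: "i d ` X \<subseteq> Field sg"
      using iF[OF d] X(1) by blast
    obtain z0 where z0: "z0 \<in> Field sg" "i d ` X \<subseteq> underS sg z0"
      by (rule sg.small_bounded[OF XF sg.small_image[OF X(2)]])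
    obtain z where z: "z \<in> closure_points sg G" "z0 \<in> underS sg z"
      by (rule sg.closure_points_unbounded[OF G(1) z0(1)])
    have "X \<subseteq> piece d z"
      using X(1) z0(2) underS_trans[OF sg.wo _ z(2)] by (auto simp: piece_def)
    moreover have "piece d z \<inter> underS r g = piece g z" if g: "g \<in> piece d z" for g
    proof -
      have gd: "g \<in> underS r d" "i d g \<in> underS sg z"
        using g by (auto simp: piece_def)
      have "i g x \<in> underS sg z" if x: "x \<in> underS r g" "i d x \<in> underS sg z" for x
      proof -
        obtain w where w: "w \<in> underS sg z" "i d g \<in> under sg w" "i d x \<in> under sg w"
          using underS_directed[OF sg.wo gd(2) x(2)] by blast
        then have "i g x \<in> Z1 w"
          using gd(1) x(1) unfolding Z1_def by blast
        then have "i g x \<in> underS sg (G w)"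
          using G(2) by blast
        then show ?thesis
          using underS_trans[OF sg.wo] closure_pointsD(1)[OF z(1) w(1)] by blast
      qed
      moreover have "i d x \<in> underS sg z" if x: "x \<in> underS r g" "i g x \<in> underS sg z" for x
      proof -
        obtain w where w: "w \<in> underS sg z" "i d g \<in> under sg w" "i g x \<in> under sg w"
          using underS_directed[OF sg.wo gd(2) x(2)] by blast
        then have "i d x \<in> Z2 w"
          using gd(1) x(1) unfolding Z2_def by blast
        then have "i d x \<in> underS sg (G w)"
          using G(2) by blast
        then show ?thesis
          using underS_trans[OF sg.wo] closure_pointsD(1)[OF z(1) w(1)] by blast
      qed
      ultimately show ?thesis
        using gd(1) underS_trans[OF r.wo] by (auto simp: piece_def)
    qed
    ultimately show ?thesis
      using closure_pointsD(2)[OF z(1)] by blast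
  qed
  show ?thesis
    using that[of piece] p_sub p_small good by simp
qed


text \<open>
  This is the case in which \<open>r\<close> is the successor of \<open>sg\<close>. A guess is a coherent piece rounded down
  to a guessing set \<open>E\<close> of closure points. Its part below a point \<open>x = fl w\<close> of \<open>E\<close> is the
  rounding of the part of the piece below \<open>x\<close>, which by coherence is an initial segment of the
  piece attached to \<open>w\<close>. As \<open>w\<close> is rounded down to \<open>x\<close>, it is below every larger point of \<open>E\<close>, so
  this initial segment is listed in time.
\<close>

lemma approachable_guessing_successor:
  fixes sg :: "'b rel" and k :: "'k rel"
  assumes r: "uncountable_regular r" and sg: "uncountable_regular sg" and less: "sg <o r"
    and below: "\<And>x. x \<in> Field r \<Longrightarrow> |underS r x| \<le>o sg"
    and k: "Card_order k" "k <o sg"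
  shows "\<exists>BB. approachable_guessing k r BB"
proof -
  interpret r: uncountable_regular r by (rule r)
  interpret sg: uncountable_regular sg by (rule sg)
  obtain piece :: "'a \<Rightarrow> 'b \<Rightarrow> 'a set"
    where p_sub: "\<And>d z. d \<in> Field r \<Longrightarrow> piece d z \<subseteq> underS r d"
    and p_small: "\<And>d z. d \<in> Field r \<Longrightarrow> |piece d z| <o sg"
    and p_good: "\<And>d X. d \<in> Field r \<Longrightarrow> X \<subseteq> underS r d \<Longrightarrow> |X| <o sg \<Longrightarrow>
      \<exists>z\<in>Field sg. X \<subseteq> piece d z \<and> (\<forall>g\<in>piece d z. piece d z \<inter> underS r g = piece g z)"
    by (rule coherent_pieces[OF r sg below], assumption, rule that)
  define I where "I = {(d, z). d \<in> Field r \<and> z \<in> Field sg \<and>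
    (\<forall>g\<in>piece d z. piece d z \<inter> underS r g = piece g z)}"
  have large: "\<exists>i\<in>I. k \<le>o |closure_points r G \<inter> case_prod piece i|"
    if G: "\<And>x. x \<in> Field r \<Longrightarrow> G x \<in> Field r" for G
  proof -
    obtain X where X: "X \<subseteq> closure_points r G" "|X| =o k"
      by (rule r.closure_points_large[of G k, OF G k(1) ordLess_transitive[OF k(2) less]])
    have Xs: "|X| <o sg"
      by (rule ordIso_ordLess_trans[OF X(2) k(2)])
    have XF: "X \<subseteq> Field r"
      using X(1) by (auto simp: closure_points_def)
    obtain d where d: "d \<in> Field r" "X \<subseteq> underS r d"
      by (rule r.small_bounded[OF XF ordLess_transitive[OF Xs less]])
    obtain z where z: "z \<in> Field sg" "X \<subseteq> piece d z"
      "\<forall>g\<in>piece d z. piece d z \<inter> underS r g = piece g z"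
      using p_good[OF d Xs] by blast
    have "k \<le>o |closure_points r G \<inter> piece d z|"
      by (rule ordIso_ordLeq_trans[OF ordIso_symmetric[OF X(2)] card_of_mono1]) (use X(1) z(2) in blast)
    then show ?thesis
      using d(1) z by (intro bexI[of _ "(d, z)"]) (auto simp: I_def)
  qed
  have I_sub: "case_prod piece i \<subseteq> Field r" and I_small: "|case_prod piece i| <o sg" if "i \<in> I" for i
    using p_sub p_small that underS_imp_Field(1) by (fastforce simp: I_def)+
  obtain H where HF: "\<And>x. x \<in> Field r \<Longrightarrow> H x \<in> Field r"
    and H: "\<And>G. (\<forall>x\<in>Field r. G x \<in> Field r) \<Longrightarrow>
      \<exists>i\<in>I. k \<le>o |floor_in r (closure_points r H) ` case_prod piece i| \<and>
         floor_in r (closure_points r H) ` case_prod piece i \<subseteq> closure_points r G"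
    using club_guessing[OF r sg less I_small I_sub large] by auto
  define E where "E = closure_points r H"
  define fl where "fl = floor_in r E"
  define BB where "BB h = (\<lambda>(g, b, z). fl ` (piece g z \<inter> underS r b)) ` (under r h \<times> under r h \<times> Field sg)" for h
  have sgr: "|Field sg| <o r"
    by (rule ordIso_ordLess_trans[OF card_of_Field_ordIso[OF sg.card] less])
  have "|BB h| <o r" for h
    unfolding BB_def
    by (rule r.small_image[OF r.small_Times[OF r.small_under r.small_Times[OF r.small_under sgr]]])
  moreover have "\<exists>h\<in>Field r. \<exists>a\<in>BB h. a \<subseteq> closure_points r G \<and> k \<le>o |a| \<and> |a| <o r \<and>
         (\<forall>x\<in>a. \<forall>y\<in>a. x \<in> underS r y \<longrightarrow> (\<exists>h\<in>underS r y. a \<inter> underS r x \<in> BB h))"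
    if G: "\<forall>x\<in>Field r. G x \<in> Field r" for G
  proof -
    obtain d z where dz: "(d, z) \<in> I" and a: "k \<le>o |fl ` piece d z|" "fl ` piece d z \<subseteq> closure_points r G"
      using H[OF G] unfolding fl_def E_def by (auto split: prod.splits)
    have d: "d \<in> Field r" and z: "z \<in> Field sg"
      and coh: "\<And>g. g \<in> piece d z \<Longrightarrow> piece d z \<inter> underS r g = piece g z"
      using dz unfolding I_def by auto
    have dd: "d \<in> under r d"
      using le_refl_Field[OF r.wo d] by (simp add: under_def)
    have "piece d z \<inter> underS r d = piece d z"
      using p_sub[OF d] by (rule Int_absorb2)
    then have "fl ` piece d z \<in> BB d"
      unfolding BB_def using dd z by (intro image_eqI[of _ _ "(d, d, z)"]) simp_all
    moreover have "|fl ` piece d z| <o r"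
      by (rule r.small_image[OF ordLess_transitive[OF p_small[OF d] less]])
    moreover have "\<exists>h\<in>underS r y. fl ` piece d z \<inter> underS r x \<in> BB h"
      if x: "x \<in> fl ` piece d z" and y: "y \<in> fl ` piece d z" and xy: "x \<in> underS r y" for x y
    proof -
      have pF: "u \<in> Field r" if "u \<in> piece d z" for u
        by (rule underS_imp_Field(1)[OF subsetD[OF p_sub[OF d] that]])
      have fE: "fl u \<in> E" "(fl u, u) \<in> r" "\<And>e. e \<in> E \<Longrightarrow> (e, u) \<in> r \<Longrightarrow> (e, fl u) \<in> r"
        if "u \<in> piece d z" for u
        unfolding fl_def E_def
        by (rule floor_in_closure_points(1-3)[OF r.wo pF[OF that]]; assumption)+
      obtain w where w: "w \<in> piece d z" "x = fl w"
        using x by blast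
      have yE: "y \<in> E" and xE: "x \<in> E"
        using x y fE(1) by blast+
      have xF: "x \<in> Field r" and yF: "y \<in> Field r"
        using underS_imp_Field[OF xy] by auto
      have wy: "w \<in> underS r y"
      proof (rule ccontr)
        assume "w \<notin> underS r y"
        then have "(y, w) \<in> r"
          using not_le_iff[OF r.wo yF pF[OF w(1)]] by blast
        then have "(y, x) \<in> r"
          using fE(3)[OF w(1) yE] w(2) by simp
        then show False
          using xy not_le_iff[OF r.wo yF xF] by blast
      qed
      have xw: "(x, w) \<in> r"
        using fE(2)[OF w(1)] w(2) by simp
      have fl_less: "fl u \<in> underS r x \<longleftrightarrow> u \<in> underS r x" if u: "u \<in> piece d z" for u
      proof
        assume "u \<in> underS r x"
        then show "fl u \<in> underS r x"
          by (rule le_underS_trans[OF r.wo fE(2)[OF u]])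
      next
        assume fu: "fl u \<in> underS r x"
        show "u \<in> underS r x"
        proof (rule ccontr)
          assume "u \<notin> underS r x"
          then have "(x, u) \<in> r"
            using not_le_iff[OF r.wo xF pF[OF u]] by blast
          then have "(x, fl u) \<in> r"
            by (rule fE(3)[OF u xE])
          then show False
            using fu not_le_iff[OF r.wo xF underS_imp_Field(1)[OF fu]] by blast
        qed
      qed
      have "fl ` piece d z \<inter> underS r x = fl ` (piece d z \<inter> underS r x)"
        using fl_less by blast
      also have "piece d z \<inter> underS r x = piece w z \<inter> underS r x"
        using coh[OF w(1)] underS_le_trans[OF r.wo _ xw, of _] by auto
      finally have "fl ` piece d z \<inter> underS r x \<in> BB w"
        unfolding BB_def using z xw le_refl_Field[OF r.wo pF[OF w(1)]]
        by (intro image_eqI[of _ _ "(w, x, z)"]) (simp_all add: under_def)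
      then show ?thesis
        using wy by blast
    qed
    ultimately show ?thesis
      using d a by blast
  qed
  ultimately have "approachable_guessing k r BB"
    unfolding approachable_guessing_def by blast
  then show ?thesis
    by (rule exI[of _ BB])
qed

lemma lub_mono_cofinal:
  assumes "Well_order r" "X \<subseteq> Field r" "Y \<subseteq> Field r"
    and u: "u \<in> Field r" "\<And>x. x \<in> X \<Longrightarrow> (x, u) \<in> r" and v: "v \<in> Field r" "\<And>y. y \<in> Y \<Longrightarrow> (y, v) \<in> r"
    and cof: "\<And>x. x \<in> X \<Longrightarrow> \<exists>y\<in>Y. (x, y) \<in> r"
  shows "(lub r X, lub r Y) \<in> r"
proof (rule lub_least[OF assms(1,2)])
  show "lub r Y \<in> Field r"
    by (rule lub_Field[OF assms(1,3) v])
  fix x assume "x \<in> X"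
  then obtain y where "y \<in> Y" "(x, y) \<in> r"
    using cof by blast
  then show "(x, lub r Y) \<in> r"
    using le_trans_rel[OF assms(1)] lub_upper[OF assms(1,3) v] by blast
qed

text \<open>
  Guesses on \<open>tau\<close> are carried to \<open>lam\<close> along cofinal sequences. Fix such a sequence \<open>e d\<close> for
  each \<open>d\<close> that has one. Given a function on \<open>lam\<close>, build an increasing sequence \<open>x\<close> of its
  closure points of length \<open>tau\<close>, with supremum \<open>d\<close>. The partial suprema of \<open>x\<close> and of \<open>e d\<close> agree
  at the closure points of some function on \<open>tau\<close>, so a guess \<open>C\<close> of these yields the same set \<open>a\<close>
  from \<open>x\<close> as from \<open>e d\<close>. For approachability, \<open>x\<close> is built such that an initial segment of \<open>x\<close>
  along \<open>C\<close> that is obtained from any of the sequences \<open>e b\<close> is obtained from one with \<open>b\<close> below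
  the next value of \<open>x\<close>; the index \<open>d\<close>, which is only found at the end, shows that some \<open>b\<close>
  exists.
\<close>

lemma approachable_guessing_transport:
  fixes lam :: "'a rel" and tau :: "'b rel" and k :: "'k rel"
  assumes lam: "uncountable_regular lam" and tau: "uncountable_regular tau" and less: "tau <o lam"
    and guess: "approachable_guessing k tau CC0"
  shows "\<exists>BB. approachable_guessing k lam BB"
proof -
  interpret l: uncountable_regular lam by (rule lam)
  interpret t: uncountable_regular tau by (rule tau)
  define CC where "CC = (\<Union>h\<in>Field tau. CC0 h)"
  have tau_small: "|Field tau| <o lam"
    by (rule ordIso_ordLess_trans[OF card_of_Field_ordIso[OF t.card] less])
  have CC_small: "|CC| <o lam"
    unfolding CC_def
  proof (rule l.small_UN[OF tau_small])
    fix h assume "h \<in> Field tau"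
    then have "|CC0 h| <o tau"
      using guess unfolding approachable_guessing_def by simp
    then show "|CC0 h| <o lam"
      by (rule ordLess_transitive[OF _ less])
  qed
  have tsmall: "|underS tau i| <o lam" for i
    by (rule ordLess_transitive[OF t.small_underS less])
  define cof where "cof b e \<longleftrightarrow> (\<forall>i\<in>Field tau. e i \<in> underS lam b) \<and>
    (\<forall>x\<in>underS lam b. \<exists>i\<in>Field tau. x \<in> underS lam (e i))" for b and e :: "'b \<Rightarrow> 'a"
  define e where "e b = (SOME e. cof b e)" for b
  \<comment> \<open>Taking suprema of the values at smaller arguments makes a sequence continuous.\<close>
  define hat where "hat x i = lub lam (x ` underS tau i)" for x i
  define BB where "BB h = (\<lambda>(b, C). hat (e b) ` C) ` (under lam h \<times> CC) \<union>
    (\<lambda>(b, C, i). hat (e b) ` (C \<inter> underS tau i)) ` (under lam h \<times> CC \<times> Field tau)" for h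
  have "|BB h| <o lam" for h
    unfolding BB_def
    by (intro l.small_Un l.small_image l.small_Times l.small_under CC_small tau_small)
  moreover have "\<exists>h\<in>Field lam. \<exists>a\<in>BB h. a \<subseteq> closure_points lam G \<and> k \<le>o |a| \<and> |a| <o lam \<and>
         (\<forall>x\<in>a. \<forall>y\<in>a. x \<in> underS lam y \<longrightarrow> (\<exists>h\<in>underS lam y. a \<inter> underS lam x \<in> BB h))"
    if G: "\<forall>x\<in>Field lam. G x \<in> Field lam" for G
  proof -
    define E where "E = closure_points lam G"
    have EF: "E \<subseteq> Field lam"
      by (auto simp: E_def closure_points_def)
    \<comment> \<open>The third conjunct asks for an early listing whenever there is a listing at all.\<close>
    define P where "P f i y \<longleftrightarrow> y \<in> E \<and> (\<forall>j\<in>underS tau i. f j \<in> underS lam y) \<and>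
      (\<forall>C\<in>CC. (\<exists>b\<in>Field lam. hat f ` (C \<inter> underS tau i) = hat (e b) ` (C \<inter> underS tau i)) \<longrightarrow>
         (\<exists>b\<in>underS lam y. hat f ` (C \<inter> underS tau i) = hat (e b) ` (C \<inter> underS tau i)))" for f i y
    have "\<exists>f. \<forall>i. P f i (f i)"
    proof (rule dependent_wf_choice)
      show "wf (tau - Id)"
        using t.wo by (simp add: well_order_on_def)
    next
      fix f g :: "'b \<Rightarrow> 'a" and i y assume "\<And>z. (z, i) \<in> tau - Id \<Longrightarrow> f z = g z"
      then have eq: "f z = g z" if "z \<in> underS tau i" for z
        using that by (simp add: underS_def)
      have "hat f z = hat g z" if "z \<in> underS tau i" for z
        unfolding hat_def using eq underS_trans[OF t.wo _ that]
        by (metis (no_types, lifting) image_cong)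
      then have "hat f ` (C \<inter> underS tau i) = hat g ` (C \<inter> underS tau i)" for C
        by (auto intro!: image_cong)
      then show "P f i y = P g i y"
        unfolding P_def using eq by simp
    next
      fix i and f :: "'b \<Rightarrow> 'a" assume IH: "\<And>y. (y, i) \<in> tau - Id \<Longrightarrow> P f y (f y)"
      have fF: "f ` underS tau i \<subseteq> Field lam"
      proof
        fix y assume "y \<in> f ` underS tau i"
        then obtain j where "y = f j" "P f j (f j)"
          using IH by (auto simp: underS_def)
        then show "y \<in> Field lam"
          using EF by (auto simp: P_def)
      qed
      have "\<exists>b. b \<in> Field lam \<and> ((\<exists>b\<in>Field lam. hat f ` (C \<inter> underS tau i) = hat (e b) ` (C \<inter> underS tau i)) \<longrightarrow>
        hat f ` (C \<inter> underS tau i) = hat (e b) ` (C \<inter> underS tau i))" for C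
        using l.inf by (metis finite.emptyI subset_empty subsetI)
      then obtain bd where bd: "\<And>C. bd C \<in> Field lam"
        "\<And>C. \<exists>b\<in>Field lam. hat f ` (C \<inter> underS tau i) = hat (e b) ` (C \<inter> underS tau i) \<Longrightarrow>
        hat f ` (C \<inter> underS tau i) = hat (e (bd C)) ` (C \<inter> underS tau i)"
        by metis
      have sub: "f ` underS tau i \<union> bd ` CC \<subseteq> Field lam"
        using fF bd(1) by blast
      obtain u where u: "u \<in> Field lam" "f ` underS tau i \<union> bd ` CC \<subseteq> underS lam u"
        by (rule l.small_bounded[OF sub l.small_Un[OF l.small_image[OF tsmall] l.small_image[OF CC_small]]])
      obtain y where y: "y \<in> E" "u \<in> underS lam y"
        unfolding E_def by (rule l.closure_points_unbounded[OF bspec[OF G] u(1)])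
      have below: "z \<in> underS lam y" if "z \<in> f ` underS tau i \<union> bd ` CC" for z
        by (rule underS_trans[OF l.wo subsetD[OF u(2) that] y(2)])
      have "P f i y"
        unfolding P_def
      proof (intro conjI ballI impI)
        show "y \<in> E"
          by (rule y(1))
        show "f j \<in> underS lam y" if "j \<in> underS tau i" for j
          using below that by blast
        fix C assume "C \<in> CC" "\<exists>b\<in>Field lam. hat f ` (C \<inter> underS tau i) = hat (e b) ` (C \<inter> underS tau i)"
        then show "\<exists>b\<in>underS lam y. hat f ` (C \<inter> underS tau i) = hat (e b) ` (C \<inter> underS tau i)"
          using bd(2) below[of "bd C"] by (intro bexI[of _ "bd C"]) auto
      qed
      then show "\<exists>y. P f i y"
        by (rule exI[of _ y])
    qed
    then obtain x where x: "\<And>i. P x i (x i)"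
      by (elim exE) (rule that, erule spec)
    have xE: "x i \<in> E" and xF: "x i \<in> Field lam" and xmono: "j \<in> underS tau i \<Longrightarrow> x j \<in> underS lam (x i)" for i j
      using x[of i] EF unfolding P_def by auto
    have xb: "\<exists>b\<in>underS lam (x i). hat x ` (C \<inter> underS tau i) = hat (e b) ` (C \<inter> underS tau i)"
      if "C \<in> CC" "b \<in> Field lam" "hat x ` (C \<inter> underS tau i) = hat (e b) ` (C \<inter> underS tau i)" for C b i
      using x[of i] that unfolding P_def by blast
    have rF: "x ` Field tau \<subseteq> Field lam"
      using xF by blast
    obtain u where u: "u \<in> Field lam" "x ` Field tau \<subseteq> underS lam u"
      by (rule l.small_bounded[OF rF l.small_image[OF tau_small]])
    have ub: "y \<in> x ` Field tau \<Longrightarrow> (y, u) \<in> lam" for y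
      using u(2) by (auto simp: underS_def)
    define d where "d = lub lam (x ` Field tau)"
    have dF: "d \<in> Field lam"
      unfolding d_def by (rule lub_Field[OF l.wo rF u(1) ub])
    have xd: "x i \<in> underS lam d" if i: "i \<in> Field tau" for i
    proof -
      obtain j where j: "j \<in> Field tau" "i \<in> underS tau j"
        using infinite_Card_order_limit[OF t.card t.inf i] by (auto simp: underS_def)
      then have "(x j, d) \<in> lam"
        unfolding d_def by (intro lub_upper[OF l.wo rF u(1) ub]) auto
      then show ?thesis
        by (rule underS_le_trans[OF l.wo xmono[OF j(2)]])
    qed
    have dx: "\<exists>i\<in>Field tau. y \<in> underS lam (x i)" if "y \<in> underS lam d" for y
      using less_lub[OF l.wo rF u(1) ub] that unfolding d_def by blast
    have "cof d x"
      unfolding cof_def using xd dx by blast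
    then have "cof d (e d)"
      unfolding e_def by (rule someI[of "cof d" x])
    then have ed: "\<And>i. i \<in> Field tau \<Longrightarrow> e d i \<in> underS lam d"
      and de: "\<And>y. y \<in> underS lam d \<Longrightarrow> \<exists>i\<in>Field tau. y \<in> underS lam (e d i)"
      unfolding cof_def by blast+
    have "\<exists>j. i \<in> Field tau \<longrightarrow> j \<in> Field tau \<and> i \<in> underS tau j \<and>
      (\<exists>p\<in>underS tau j. e d i \<in> underS lam (x p)) \<and> (\<exists>p\<in>underS tau j. x i \<in> underS lam (e d p))" for i
    proof (cases "i \<in> Field tau")
      case True
      obtain p where p: "p \<in> Field tau" "e d i \<in> underS lam (x p)"
        using dx[OF ed[OF True]] by blast
      obtain q where q: "q \<in> Field tau" "x i \<in> underS lam (e d q)"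
        using de[OF xd[OF True]] by blast
      have s: "{i, p, q} \<subseteq> Field tau"
        using True p(1) q(1) by simp
      obtain j where "j \<in> Field tau" "{i, p, q} \<subseteq> underS tau j"
        by (rule t.small_bounded[OF s t.small_finite]) auto
      then show ?thesis
        using p q by blast
    qed simp
    then obtain Gt where Gt: "\<And>i. i \<in> Field tau \<Longrightarrow> Gt i \<in> Field tau" "\<And>i. i \<in> Field tau \<Longrightarrow> i \<in> underS tau (Gt i)"
      and Gt1: "\<And>i. i \<in> Field tau \<Longrightarrow> \<exists>p\<in>underS tau (Gt i). e d i \<in> underS lam (x p)"
      and Gt2: "\<And>i. i \<in> Field tau \<Longrightarrow> \<exists>p\<in>underS tau (Gt i). x i \<in> underS lam (e d p)"
      by metis
    have imF: "f ` underS tau i \<subseteq> Field lam" "\<And>y. y \<in> f ` underS tau i \<Longrightarrow> (y, d) \<in> lam"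
      if "\<And>i. i \<in> Field tau \<Longrightarrow> f i \<in> underS lam d" for f i
      using that underS_imp_Field(1)[of _ tau i] underS_imp_Field(1)[of _ lam d] underS_imp_le[of _ lam d] by auto
    note ix = imF[of x, OF xd] and ie = imF[of "e d", OF ed]
    have hat_eq: "hat x i = hat (e d) i" if i: "i \<in> closure_points tau Gt" for i
    proof -
      have "(hat x i, hat (e d) i) \<in> lam"
        unfolding hat_def
      proof (rule lub_mono_cofinal[OF l.wo ix(1) ie(1) dF ix(2) dF ie(2)])
        fix y assume "y \<in> x ` underS tau i"
        then obtain j where j: "j \<in> underS tau i" "y = x j"
          by blast
        obtain p where p: "p \<in> underS tau (Gt j)" "x j \<in> underS lam (e d p)"
          using Gt2[OF underS_imp_Field(1)[OF j(1)]] by blast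
        have "p \<in> underS tau i"
          by (rule underS_trans[OF t.wo p(1) closure_pointsD(1)[OF i j(1)]])
        then show "\<exists>z\<in>e d ` underS tau i. (y, z) \<in> lam"
          using p(2) j(2) underS_imp_le[of y lam] by blast
      qed
      moreover have "(hat (e d) i, hat x i) \<in> lam"
        unfolding hat_def
      proof (rule lub_mono_cofinal[OF l.wo ie(1) ix(1) dF ie(2) dF ix(2)])
        fix y assume "y \<in> e d ` underS tau i"
        then obtain j where j: "j \<in> underS tau i" "y = e d j"
          by blast
        obtain p where p: "p \<in> underS tau (Gt j)" "e d j \<in> underS lam (x p)"
          using Gt1[OF underS_imp_Field(1)[OF j(1)]] by blast
        have "p \<in> underS tau i"
          by (rule underS_trans[OF t.wo p(1) closure_pointsD(1)[OF i j(1)]])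
        then show "\<exists>z\<in>x ` underS tau i. (y, z) \<in> lam"
          using p(2) j(2) underS_imp_le[of y lam] by blast
      qed
      moreover have "antisym lam"
        using l.wo by (simp add: order_on_defs)
      ultimately show ?thesis
        by (auto dest: antisymD)
    qed
    have above: "x j \<in> underS lam (hat x i)" if i: "i \<in> closure_points tau Gt" and j: "j \<in> underS tau i" for i j
    proof -
      have jF: "j \<in> Field tau"
        by (rule underS_imp_Field(1)[OF j])
      have "(x (Gt j), hat x i) \<in> lam"
        unfolding hat_def using closure_pointsD(1)[OF i j]
        by (intro lub_upper[OF l.wo ix(1) dF ix(2)]) auto
      then show ?thesis
        by (rule underS_le_trans[OF l.wo xmono[OF Gt(2)[OF jF]]])
    qed
    have hat_le: "(hat x i, x i) \<in> lam" for i
      unfolding hat_def by (rule lub_least[OF l.wo ix(1) xF]) (use xmono in \<open>auto simp: underS_imp_le\<close>)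
    have hat_mono: "hat x j \<in> underS lam (hat x i)" if "i \<in> closure_points tau Gt" "j \<in> underS tau i" for i j
      by (rule le_underS_trans[OF l.wo hat_le above[OF that]])
    have hat_E: "hat x i \<in> E" for i
      unfolding hat_def E_def
      by (rule lub_closure_points[OF l.wo _ dF ix(2)]) (use xE in \<open>auto simp: E_def\<close>)
    obtain h C where h: "h \<in> Field tau" "C \<in> CC0 h" and C: "C \<subseteq> closure_points tau Gt" "k \<le>o |C|" "|C| <o tau"
      using guess Gt(1) unfolding approachable_guessing_def by blast
    have CC: "C \<in> CC"
      using h by (auto simp: CC_def)
    have CF: "C \<subseteq> Field tau"
      using C(1) by (auto simp: closure_points_def)
    define a where "a = hat x ` C"
    have hat_iff: "hat x j \<in> underS lam (hat x i) \<longleftrightarrow> j \<in> underS tau i" if "i \<in> C" "j \<in> C" for i j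
      using hat_mono[of i j] hat_mono[of j i] underS_linear[OF t.wo, of i j] that CF C(1)
        underS_asym[OF l.wo, of "hat x j" "hat x i"] underS_irrefl[of "hat x i" lam]
      by auto
    have "inj_on (hat x) C"
    proof (rule inj_onI)
      fix i j assume ij: "i \<in> C" "j \<in> C" "hat x i = hat x j"
      then show "i = j"
        using hat_iff[of i j] hat_iff[of j i] underS_irrefl[of "hat x i" lam] underS_linear[OF t.wo, of i j] CF
        by auto
    qed
    then have "|C| \<le>o |a|"
      unfolding a_def by (rule card_of_ordLeqI) auto
    then have ka: "k \<le>o |a|"
      by (rule ordLeq_transitive[OF C(2)])
    have "a = hat (e d) ` C"
      unfolding a_def using hat_eq C(1) by (intro image_cong) auto
    then have "a \<in> BB d"
      unfolding BB_def using CC le_refl_Field[OF l.wo dF]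
      by (intro UnI1 image_eqI[of _ _ "(d, C)"]) (simp_all add: under_def)
    moreover have "|a| <o lam"
      unfolding a_def by (rule l.small_image[OF ordLess_transitive[OF C(3) less]])
    moreover have "a \<subseteq> E"
      unfolding a_def using hat_E by blast
    moreover have "\<exists>h\<in>underS lam z. a \<inter> underS lam y \<in> BB h"
      if y: "y \<in> a" and z: "z \<in> a" and yz: "y \<in> underS lam z" for y z
    proof -
      obtain i j where ij: "i \<in> C" "j \<in> C" "y = hat x i" "z = hat x j"
        using y z unfolding a_def by blast
      have lt: "i \<in> underS tau j"
        using hat_iff[OF ij(2,1)] yz ij(3,4) by simp
      have eq: "a \<inter> underS lam y = hat x ` (C \<inter> underS tau i)"
        unfolding a_def ij(3) using hat_iff[OF ij(1)] by auto
      have "hat x ` (C \<inter> underS tau i) = hat (e d) ` (C \<inter> underS tau i)"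
        using hat_eq C(1) by (intro image_cong) auto
      from xb[OF CC dF this] obtain b where b: "b \<in> underS lam (x i)"
        "hat x ` (C \<inter> underS tau i) = hat (e b) ` (C \<inter> underS tau i)"
        by (elim bexE) (rule that)
      have "a \<inter> underS lam y \<in> BB b"
        unfolding BB_def eq b(2)
        using CC subsetD[OF CF ij(1)] le_refl_Field[OF l.wo underS_imp_Field(1)[OF b(1)]]
        by (intro UnI2 image_eqI[of _ _ "(b, C, i)"]) (simp_all add: under_def)
      moreover have "b \<in> underS lam z"
        unfolding ij(4) by (rule underS_trans[OF l.wo b(1) above[OF subsetD[OF C(1) ij(2)] lt]])
      ultimately show ?thesis
        by blast
    qed
    ultimately show ?thesis
      unfolding E_def using dF ka by blast
  qed
  ultimately have "approachable_guessing k lam BB"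
    unfolding approachable_guessing_def by blast
  then show ?thesis
    by (rule exI[of _ BB])
qed

lemma uncountable_regular_cardSuc:
  assumes "Card_order k" "cinfinite k"
  shows "uncountable_regular (cardSuc k)"
proof
  show "Card_order (cardSuc k)"
    by (rule cardSuc_Card_order[OF assms(1)])
  show "regularCard (cardSuc k)"
    by (rule regularCard_cardSuc) (use assms in simp)
  show "natLeq <o cardSuc k"
    by (rule ordLeq_ordLess_trans[OF natLeq_ordLeq_cinfinite cardSuc_greater[OF assms(1)]]) (use assms in simp)
qed

text \<open>
  If \<open>lam\<close> exceeds the second successor of \<open>k\<close>, the family is carried up from that successor;
  otherwise \<open>lam\<close> is that successor. It is needed there that the smaller cardinal of
  \<open>club_guessing\<close>, the first successor of \<open>k\<close>, is regular, whereas \<open>k\<close> may be singular.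
\<close>

theorem approachable_guessing_exists:
  assumes lam: "uncountable_regular lam" and k: "Card_order k" "cinfinite k" and less: "cardSuc k <o lam"
  shows "\<exists>BB. approachable_guessing k lam BB"
proof -
  interpret l: uncountable_regular lam by (rule lam)
  let ?s = "cardSuc k" and ?t = "cardSuc (cardSuc k)"
  have s: "uncountable_regular ?s"
    by (rule uncountable_regular_cardSuc[OF k])
  interpret s: uncountable_regular ?s by (rule s)
  have t: "uncountable_regular ?t"
    by (rule uncountable_regular_cardSuc) (use s.Cinf in simp_all)
  interpret t: uncountable_regular ?t by (rule t)
  have ks: "k <o ?s"
    by (rule cardSuc_greater[OF k(1)])
  have below: "|A| \<le>o ?s" if "|A| <o ?t" for A :: "'x set"
    using that cardSuc_ordLeq_ordLess[OF s.card card_of_Card_order] by blast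
  show ?thesis
  proof (cases "?t <o lam")
    case True
    have "\<exists>BB. approachable_guessing k ?t BB"
      by (rule approachable_guessing_successor[OF t s cardSuc_greater[OF s.card] _ k(1) ks])
        (rule below[OF t.small_underS])
    then show ?thesis
      using approachable_guessing_transport[OF lam t True] by blast
  next
    case False
    then have "lam \<le>o ?t"
      using ordLess_or_ordLeq[OF t.wo l.wo] by blast
    then have "|underS lam x| \<le>o ?s" for x
      by (intro below ordLess_ordLeq_trans[OF l.small_underS])
    then show ?thesis
      by (intro approachable_guessing_successor[OF lam s less _ k(1) ks])
  qed
qed

section \<open>Lexicographic orders with small cofinalities\<close>

definition lex_fun :: "'i rel \<Rightarrow> 'q rel \<Rightarrow> ('i \<Rightarrow> 'q) set \<Rightarrow> ('i \<Rightarrow> 'q) rel" where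
  "lex_fun w R M = {(f, g). f \<in> M \<and> g \<in> M \<and>
     (f = g \<or> (\<exists>i\<in>Field w. (\<forall>j\<in>underS w i. f j = g j) \<and> f i \<noteq> g i \<and> (f i, g i) \<in> R))}"

lemma lexI: "f \<in> M \<Longrightarrow> g \<in> M \<Longrightarrow> i \<in> Field w \<Longrightarrow> (\<And>j. j \<in> underS w i \<Longrightarrow> f j = g j) \<Longrightarrow>
    f i \<noteq> g i \<Longrightarrow> (f i, g i) \<in> R \<Longrightarrow> (f, g) \<in> lex_fun w R M"
  unfolding lex_fun_def by blast

locale lex_space =
  fixes w :: "'i rel" and Q :: "'q set" and R and M :: "('i \<Rightarrow> 'q) set"
  assumes wo: "Well_order w" and lin: "linear_order_on Q R"
    and val: "f \<in> M \<Longrightarrow> i \<in> Field w \<Longrightarrow> f i \<in> Q"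
    and ext: "f \<in> M \<Longrightarrow> g \<in> M \<Longrightarrow> (\<And>i. i \<in> Field w \<Longrightarrow> f i = g i) \<Longrightarrow> f = g"
begin

lemma R_trans: "(x, y) \<in> R \<Longrightarrow> (y, z) \<in> R \<Longrightarrow> (x, z) \<in> R"
  using lin by (auto simp: order_on_defs dest: transD)

lemma R_antisym: "(x, y) \<in> R \<Longrightarrow> (y, x) \<in> R \<Longrightarrow> x = y"
  using lin by (auto simp: order_on_defs dest: antisymD)

lemma R_total: "x \<in> Q \<Longrightarrow> y \<in> Q \<Longrightarrow> x \<noteq> y \<Longrightarrow> (x, y) \<in> R \<or> (y, x) \<in> R"
  using lin by (auto simp: order_on_defs total_on_def)

lemma first_difference:
  assumes "f \<in> M" "g \<in> M" "f \<noteq> g"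
  obtains i where "i \<in> Field w" "f i \<noteq> g i" "\<And>j. j \<in> underS w i \<Longrightarrow> f j = g j"
proof -
  let ?S = "{i \<in> Field w. f i \<noteq> g i}"
  have "?S \<noteq> {}"
    using ext[OF assms(1,2)] assms(3) by blast
  then obtain i where i: "i \<in> ?S" "\<And>j. j \<in> ?S \<Longrightarrow> (i, j) \<in> w"
    by (rule least_exists[OF wo, rotated]) auto
  have "f j = g j" if j: "j \<in> underS w i" for j
    using i not_le_iff[OF wo, of i j] underS_imp_Field[OF j] j by blast
  then show ?thesis
    using that i(1) by blast
qed

lemma lex_less_iff:
  assumes "f \<in> M" "g \<in> M" "i \<in> Field w" "f i \<noteq> g i" "\<And>j. j \<in> underS w i \<Longrightarrow> f j = g j"
  shows "(f, g) \<in> lex_fun w R M \<longleftrightarrow> (f i, g i) \<in> R"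
proof
  assume "(f, g) \<in> lex_fun w R M"
  then obtain j where j: "j \<in> Field w" "\<And>l. l \<in> underS w j \<Longrightarrow> f l = g l" "f j \<noteq> g j" "(f j, g j) \<in> R"
    using assms(4) unfolding lex_fun_def by auto
  then have "j = i"
    using underS_linear[OF wo assms(3) j(1)] assms(4,5) by blast
  then show "(f i, g i) \<in> R"
    using j(4) by simp
next
  assume "(f i, g i) \<in> R"
  then show "(f, g) \<in> lex_fun w R M"
    using assms(5) by (rule lexI[OF assms(1-3) _ assms(4), rotated])
qed

lemma lex_linear: "linear_order_on M (lex_fun w R M)"
proof -
  let ?L = "lex_fun w R M"
  have "refl_on M ?L"
    by (auto simp: refl_on_def lex_fun_def)
  moreover have "?L \<subseteq> M \<times> M"
    by (auto simp: lex_fun_def)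
  moreover have "trans ?L"
  proof (rule transI)
    fix f g h assume fg: "(f, g) \<in> ?L" and gh: "(g, h) \<in> ?L"
    have M: "f \<in> M" "g \<in> M" "h \<in> M"
      using fg gh by (auto simp: lex_fun_def)
    show "(f, h) \<in> ?L"
    proof (cases "f = g \<or> g = h")
      case False
      then have ne: "f \<noteq> g" "g \<noteq> h"
        by auto
      obtain i where i: "i \<in> Field w" "f i \<noteq> g i" "\<And>j. j \<in> underS w i \<Longrightarrow> f j = g j"
        by (rule first_difference[OF M(1,2) ne(1)], rule that)
      obtain j where j: "j \<in> Field w" "g j \<noteq> h j" "\<And>l. l \<in> underS w j \<Longrightarrow> g l = h l"
        by (rule first_difference[OF M(2,3) ne(2)], rule that)
      have fi: "(f i, g i) \<in> R" and gj: "(g j, h j) \<in> R"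
        using lex_less_iff[OF M(1,2) i] lex_less_iff[OF M(2,3) j] fg gh by auto
      consider "i \<in> underS w j" | "i = j" | "j \<in> underS w i"
        using underS_linear[OF wo i(1) j(1)] by blast
      then show ?thesis
      proof cases
        case 1
        show ?thesis
          by (rule lexI[OF M(1,3) i(1)]) (use 1 i j fi underS_trans[OF wo _ 1] in auto)
      next
        case 2
        have "f i \<noteq> h i"
          using fi gj i(2) 2 R_antisym by auto
        then show ?thesis
          by (intro lexI[OF M(1,3) i(1)]) (use 2 i j R_trans[OF fi] gj in auto)
      next
        case 3
        show ?thesis
          by (rule lexI[OF M(1,3) j(1)]) (use 3 i j gj underS_trans[OF wo _ 3] in auto)
      qed
    qed (use fg gh in auto)
  qed
  moreover have "antisym ?L"
  proof (rule antisymI, rule ccontr)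
    fix f g assume fg: "(f, g) \<in> ?L" "(g, f) \<in> ?L" "f \<noteq> g"
    have M: "f \<in> M" "g \<in> M"
      using fg by (auto simp: lex_fun_def)
    obtain i where i: "i \<in> Field w" "f i \<noteq> g i" "\<And>j. j \<in> underS w i \<Longrightarrow> f j = g j"
      by (rule first_difference[OF M fg(3)], rule that)
    have "(f i, g i) \<in> R"
      using lex_less_iff[OF M i] fg(1) by simp
    moreover have "(g i, f i) \<in> R"
      using lex_less_iff[of g f i] M i fg(2) by auto
    ultimately show False
      using R_antisym i(2) by blast
  qed
  moreover have "total_on M ?L"
  proof (rule total_onI)
    fix f g assume M: "f \<in> M" "g \<in> M" "f \<noteq> g"
    obtain i where i: "i \<in> Field w" "f i \<noteq> g i" "\<And>j. j \<in> underS w i \<Longrightarrow> f j = g j"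
      by (rule first_difference[OF M], rule that)
    show "(f, g) \<in> ?L \<or> (g, f) \<in> ?L"
      using R_total[OF val[OF M(1) i(1)] val[OF M(2) i(1)] i(2)]
        lex_less_iff[of f g i] lex_less_iff[of g f i] M i by auto
  qed
  ultimately show ?thesis
    by (simp add: order_on_defs)
qed

end

text \<open>
  In a linear order with this property the lower half of every cut has a cofinal set of size less
  than \<open>lam\<close>. This excludes gaps that are approached from below by \<open>lam\<close> many steps.
\<close>

definition small_cofinality :: "'l rel \<Rightarrow> 'a set \<Rightarrow> 'a rel \<Rightarrow> bool" where
  "small_cofinality lam Q R \<longleftrightarrow> (\<forall>X\<subseteq>Q. \<exists>K\<subseteq>X. |K| <o lam \<and> (\<forall>x\<in>X. \<exists>y\<in>K. (x, y) \<in> R))"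

text \<open>
  Sort the points of \<open>X\<close> that are not greatest by the least position \<open>i\<close> at which some point of
  \<open>X\<close> first exceeds them. Two points with the same \<open>i\<close> agree below \<open>i\<close>: otherwise one of them
  would be exceeded by the other at an earlier position. So for each \<open>i\<close> it suffices to choose
  witnesses for a cofinal set of values at \<open>i\<close>.
\<close>

lemma small_cofinality_lex:
  assumes lex: "lex_space w Q R M" and lam: "uncountable_regular lam" and w: "|Field w| <o lam"
    and Q: "small_cofinality lam Q R"
  shows "small_cofinality lam M (lex_fun w R M)"
  unfolding small_cofinality_def
proof (intro allI impI)
  interpret lex_space w Q R M by (rule lex)
  interpret l: uncountable_regular lam by (rule lam)
  fix X assume X: "X \<subseteq> M"
  define rise where "rise f g i \<longleftrightarrow> f \<in> X \<and> g \<in> X \<and> i \<in> Field w \<and>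
    (\<forall>j\<in>underS w i. f j = g j) \<and> f i \<noteq> g i \<and> (f i, g i) \<in> R" for f g i
  define least where "least f i \<longleftrightarrow> (\<forall>j\<in>underS w i. \<forall>g. \<not> rise f g j)" for f i
  define V where "V i = {g i | f g. rise f g i \<and> least f i}" for i
  have V_sub: "V i \<subseteq> Q" for i
    using val X unfolding V_def rise_def by auto
  have "\<exists>K. K \<subseteq> V i \<and> |K| <o lam \<and> (\<forall>x\<in>V i. \<exists>y\<in>K. (x, y) \<in> R)" for i
    using Q V_sub[of i] unfolding small_cofinality_def by blast
  then obtain K where K: "\<And>i. K i \<subseteq> V i" "\<And>i. |K i| <o lam" "\<And>i x. x \<in> V i \<Longrightarrow> \<exists>y\<in>K i. (x, y) \<in> R"
    by metis
  define p where "p i v = (SOME p. rise (fst p) (snd p) i \<and> least (fst p) i \<and> snd p i = v)" for i v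
  define F where "F i v = fst (p i v)" for i v
  define G where "G i v = snd (p i v)" for i v
  have GF: "rise (F i v) (G i v) i \<and> least (F i v) i \<and> G i v i = v" if v: "v \<in> V i" for i v
  proof -
    obtain f g where "rise f g i" "least f i" "g i = v"
      using v unfolding V_def by auto
    then have "\<exists>p. rise (fst p) (snd p) i \<and> least (fst p) i \<and> snd p i = v"
      by (intro exI[of _ "(f, g)"]) simp
    then show ?thesis
      unfolding F_def G_def p_def by (rule someI_ex)
  qed
  define T where "T = (\<Union>i\<in>Field w. G i ` K i)"
  define N where "N = {f \<in> X. \<forall>g\<in>X. (g, f) \<in> lex_fun w R M}"
  have T_small: "|T| <o lam"
    unfolding T_def by (rule l.small_UN[OF w l.small_image[OF K(2)]])
  have T_sub: "T \<subseteq> X"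
  proof
    fix g assume "g \<in> T"
    then obtain i v where "g = G i v" "v \<in> V i"
      unfolding T_def using K(1) by blast
    then show "g \<in> X"
      using GF[of v i] by (simp add: rise_def)
  qed
  have anti: "f = g" if "(f, g) \<in> lex_fun w R M" "(g, f) \<in> lex_fun w R M" for f g
    using lex_linear that by (auto simp: order_on_defs dest: antisymD)
  have "N \<subseteq> {f}" if "f \<in> N" for f
    using that anti unfolding N_def by blast
  then have "finite N"
    by (metis all_not_in_conv finite.emptyI finite.insertI finite_subset)
  then have "|T \<union> N| <o lam"
    by (intro l.small_Un T_small l.small_finite)
  moreover have "\<exists>g\<in>T \<union> N. (f, g) \<in> lex_fun w R M" if f: "f \<in> X" for f
  proof (cases "\<exists>g i. rise f g i")
    case True
    then have ne: "{i. \<exists>g. rise f g i} \<noteq> {}" and sub: "{i. \<exists>g. rise f g i} \<subseteq> Field w"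
      by (auto simp: rise_def)
    obtain i where i: "i \<in> {i. \<exists>g. rise f g i}" "\<And>j. j \<in> {i. \<exists>g. rise f g i} \<Longrightarrow> (i, j) \<in> w"
      by (rule least_exists[OF wo sub ne], rule that)
    then obtain g where g: "rise f g i"
      by blast
    have iF: "i \<in> Field w"
      using g by (simp add: rise_def)
    have lf: "least f i"
      unfolding least_def
    proof (intro ballI allI notI)
      fix j h assume j: "j \<in> underS w i" "rise f h j"
      then have "(i, j) \<in> w"
        using i(2) by blast
      then show False
        using not_le_iff[OF wo iF underS_imp_Field(1)[OF j(1)]] j(1) by blast
    qed
    have "g i \<in> V i"
      using g lf unfolding V_def by blast
    then obtain v where v: "v \<in> K i" "(g i, v) \<in> R"
      using K(3) by blast
    define f' where "f' = F i v"
    define g' where "g' = G i v"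
    have g': "rise f' g' i" "least f' i" "g' i = v"
      using GF[OF subsetD[OF K(1) v(1)]] unfolding f'_def g'_def by blast+
    have M: "f \<in> M" "f' \<in> M" "g \<in> M" "g' \<in> M"
      using g g'(1) X unfolding rise_def by auto
    have agree: "f j = f' j" if j: "j \<in> underS w i" for j
    proof (rule ccontr)
      assume "f j \<noteq> f' j"
      then have ff: "f \<noteq> f'"
        by auto
      obtain l where l: "l \<in> Field w" "f l \<noteq> f' l" "\<And>m. m \<in> underS w l \<Longrightarrow> f m = f' m"
        by (rule first_difference[OF M(1,2) ff], rule that)
      have "(l, j) \<in> w"
        using \<open>f j \<noteq> f' j\<close> l not_le_iff[OF wo l(1) underS_imp_Field(1)[OF j]] by blast
      then have li: "l \<in> underS w i"
        by (rule le_underS_trans[OF wo _ j])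
      consider "(f l, f' l) \<in> R" | "(f' l, f l) \<in> R"
        using R_total[OF val[OF M(1) l(1)] val[OF M(2) l(1)] l(2)] by blast
      then have "rise f f' l \<or> rise f' f l"
        using l g g'(1) unfolding rise_def by cases auto
      then show False
        using lf g'(2) li unfolding least_def by blast
    qed
    have fv: "(f i, v) \<in> R" "f i \<noteq> v"
      using g v(2) R_trans R_antisym unfolding rise_def by blast+
    have "(f, g') \<in> lex_fun w R M"
      by (rule lexI[OF M(1,4) iF]) (use agree g' fv in \<open>auto simp: rise_def\<close>)
    moreover have "g' \<in> T"
      unfolding T_def g'_def using iF v(1) by blast
    ultimately show ?thesis
      by blast
  next
    case False
    have "(g, f) \<in> lex_fun w R M" if g: "g \<in> X" for g
    proof (rule ccontr)
      assume n: "(g, f) \<notin> lex_fun w R M"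
      have M: "f \<in> M" "g \<in> M" and ne: "f \<noteq> g"
        using f g X n by (auto simp: lex_fun_def)
      obtain i where i: "i \<in> Field w" "f i \<noteq> g i" "\<And>j. j \<in> underS w i \<Longrightarrow> f j = g j"
        by (rule first_difference[OF M ne], rule that)
      have "(f i, g i) \<in> R"
        using lex_less_iff[of g f i] M i n R_total[OF val[OF M(1) i(1)] val[OF M(2) i(1)] i(2)] by auto
      then have "rise f g i"
        using i f g by (simp add: rise_def)
      then show False
        using False by blast
    qed
    then have "f \<in> N"
      using f by (simp add: N_def)
    then show ?thesis
      using f X by (auto simp: lex_fun_def)
  qed
  ultimately show "\<exists>K\<subseteq>X. |K| <o lam \<and> (\<forall>x\<in>X. \<exists>y\<in>K. (x, y) \<in> lex_fun w R M)"
    using T_sub by (intro exI[of _ "T \<union> N"]) (auto simp: N_def)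
qed

lemma small_cofinality_finite:
  assumes "finite Q" "linear_order_on Q R" "uncountable_regular lam"
  shows "small_cofinality lam Q R"
  unfolding small_cofinality_def
proof (intro allI impI)
  fix X assume X: "X \<subseteq> Q"
  have "|X| <o lam"
    using X assms(1) by (intro uncountable_regular.small_finite[OF assms(3)]) (rule finite_subset)
  moreover have "refl_on Q R"
    using assms(2) by (simp add: order_on_defs)
  ultimately show "\<exists>K\<subseteq>X. |K| <o lam \<and> (\<forall>x\<in>X. \<exists>y\<in>K. (x, y) \<in> R)"
    using X by (intro exI[of _ X]) (auto simp: refl_on_def)
qed

text \<open>
  For the least \<open>m\<close> with \<open>lam \<le> 2\<^sup>m\<close>, the binary tree of height \<open>m\<close> has at least \<open>lam\<close> branches
  but fewer than \<open>lam\<close> nodes on each level.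
\<close>

lemma least_power:
  assumes k: "Card_order (k :: 'k rel)" and lam: "Card_order lam" and le: "lam \<le>o |Pow (Field k)|"
  obtains m :: "'k rel" where "Card_order m" "m \<le>o k" "lam \<le>o |Pow (Field m)|"
    "\<And>i. i \<in> Field m \<Longrightarrow> |Pow (underS m i)| <o lam"
proof -
  define S where "S = {m :: 'k rel. Card_order m \<and> lam \<le>o |Pow (Field m)|}"
  have kS: "k \<in> S"
    using k le by (simp add: S_def)
  have "S \<noteq> {}" "\<forall>m\<in>S. Card_order m"
    using kS by (auto simp: S_def)
  then obtain m where m: "m \<in> S" "\<forall>m'\<in>S. m \<le>o m'"
    by (rule bexE[OF exists_minim_Card_order])
  have mC: "Card_order m"
    using m(1) by (simp add: S_def)
  have "|Pow (underS m i)| <o lam" if i: "i \<in> Field m" for i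
  proof (rule ccontr)
    assume "\<not> ?thesis"
    then have "lam \<le>o |Pow (underS m i)|"
      using ordLess_or_ordLeq[OF card_of_Well_order card_order_on_well_order_on[OF lam], of "Pow (underS m i)"]
      by auto
    then have "|underS m i| \<in> S"
      by (simp add: S_def card_of_card_order_on Field_card_of)
    then have "m \<le>o |underS m i|"
      by (rule bspec[OF m(2)])
    then show False
      using not_ordLess_ordLeq[OF card_of_underS[OF mC i]] by simp
  qed
  then show ?thesis
    using that[of m] mC m(1) bspec[OF m(2) kS] by (simp add: S_def)
qed

text \<open>
  The branches of the tree from \<open>least_power\<close> are ordered lexicographically. Those with a last
  entry \<open>True\<close> correspond to nodes and form the dense set \<open>D\<close>; it separates \<open>lam\<close> many other
  branches \<open>p x\<close>, although it has fewer than \<open>lam\<close> points.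
\<close>

lemma dense_order:
  fixes k :: "'k rel" and lam :: "'l rel"
  assumes lam: "uncountable_regular lam" and k: "Card_order k" "k <o lam" and le: "lam \<le>o |Pow (Field k)|"
  obtains Q :: "('k \<Rightarrow> bool) set" and R D p
  where "linear_order_on Q R" "small_cofinality lam Q R" "D \<subseteq> Q" "|D| <o lam" "D \<noteq> {}"
    "p ` Field lam \<subseteq> Q - D" "inj_on p (Field lam)"
    "\<And>f g. (f, g) \<in> R \<Longrightarrow> f \<noteq> g \<Longrightarrow> \<exists>d\<in>D. (f, d) \<in> R \<and> (d, g) \<in> R"
proof -
  interpret l: uncountable_regular lam by (rule lam)
  obtain m :: "'k rel" where m: "Card_order m" "m \<le>o k" "lam \<le>o |Pow (Field m)|"
    "\<And>i. i \<in> Field m \<Longrightarrow> |Pow (underS m i)| <o lam"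
    by (rule least_power[OF k(1) l.card le]) (rule that)
  have mwo: "Well_order m"
    using m(1) by (rule card_order_on_well_order_on)
  have msmall: "|Field m| <o lam"
    by (rule ordIso_ordLess_trans[OF card_of_Field_ordIso[OF m(1)] ordLeq_ordLess_trans[OF m(2) k(2)]])
  define Q where "Q = (\<lambda>T i. i \<in> T) ` Pow (Field m)"
  define B where "B = {(x :: bool, y). x \<longrightarrow> y}"
  have B: "linear_order_on UNIV B"
    by (auto simp: order_on_defs refl_on_def trans_def antisym_def total_on_def B_def)
  interpret lex_space m UNIV B Q
    by standard (use mwo B in \<open>auto simp: Q_def\<close>)
  let ?R = "lex_fun m B Q"
  have sc: "small_cofinality lam Q ?R"
    by (rule small_cofinality_lex[OF _ lam msmall small_cofinality_finite[OF _ B lam]])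
      (simp_all add: lex_space_axioms)
  define D where "D = (\<Union>i\<in>Field m. (\<lambda>T j. j = i \<or> j \<in> T) ` Pow (underS m i))"
  have D_small: "|D| <o lam"
    unfolding D_def by (rule l.small_UN[OF msmall l.small_image[OF m(4)]])
  have D_sub: "D \<subseteq> Q"
  proof
    fix d assume "d \<in> D"
    then obtain i T where iT: "i \<in> Field m" "T \<subseteq> underS m i" "d = (\<lambda>j. j = i \<or> j \<in> T)"
      unfolding D_def by blast
    then have "insert i T \<subseteq> Field m" "d = (\<lambda>j. j \<in> insert i T)"
      using underS_imp_Field(1)[of _ m i] by auto
    then show "d \<in> Q"
      unfolding Q_def by blast
  qed
  have dense: "\<exists>d\<in>D. (f, d) \<in> ?R \<and> (d, g) \<in> ?R" if fg: "(f, g) \<in> ?R" "f \<noteq> g" for f g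
  proof -
    have M: "f \<in> Q" "g \<in> Q"
      using fg(1) by (auto simp: lex_fun_def)
    obtain i where i: "i \<in> Field m" "f i \<noteq> g i" "\<And>j. j \<in> underS m i \<Longrightarrow> f j = g j"
      by (rule first_difference[OF M fg(2)], rule that)
    have fgi: "\<not> f i" "g i"
      using lex_less_iff[OF M i] fg(1) i(2) by (auto simp: B_def)
    define d where "d = (\<lambda>j. j = i \<or> j \<in> {j \<in> underS m i. g j})"
    have dD: "d \<in> D"
      unfolding D_def d_def using i(1) by blast
    then have dQ: "d \<in> Q"
      using D_sub by blast
    have dl: "d j = g j" if "j \<in> underS m i" for j
      using that by (auto simp: d_def underS_def)
    have "(f, d) \<in> ?R"
      by (rule lexI[OF M(1) dQ i(1)]) (use i dl fgi in \<open>auto simp: d_def B_def\<close>)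
    moreover have "(d, g) \<in> ?R"
    proof (cases "d = g")
      case True
      then show ?thesis
        using dQ by (simp add: lex_fun_def)
    next
      case False
      obtain j where j: "j \<in> Field m" "d j \<noteq> g j" "\<And>l. l \<in> underS m j \<Longrightarrow> d l = g l"
        by (rule first_difference[OF dQ M(2) False], rule that)
      have "j \<noteq> i"
        using j(2) fgi by (auto simp: d_def)
      then have "\<not> d j"
        using j(2) dl by (auto simp: d_def)
      then show ?thesis
        by (intro lexI[OF dQ M(2) j(1) j(3) j(2)]) (auto simp: B_def)
    qed
    ultimately show ?thesis
      using dD by blast
  qed
  have "\<not> |Q - D| <o lam"
  proof
    assume "|Q - D| <o lam"
    then have "|(Q - D) \<union> D| <o lam"
      by (rule l.small_Un[OF _ D_small])
    then have "|Q| <o lam"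
      using D_sub by (simp add: Un_absorb2)
    moreover have "|Pow (Field m)| \<le>o |Q|"
    proof (rule card_of_ordLeqI)
      show "inj_on (\<lambda>T i. i \<in> T) (Pow (Field m))"
        by (rule inj_onI) (simp add: fun_eq_iff set_eq_iff)
    qed (simp add: Q_def)
    ultimately show False
      using not_ordLess_ordLeq[of "|Q|" lam] ordLeq_transitive[OF m(3), of "|Q|"] by simp
  qed
  then have "lam \<le>o |Q - D|"
    using ordLess_or_ordLeq[OF card_of_Well_order l.wo, of "Q - D"] by auto
  then have "|Field lam| \<le>o |Q - D|"
    by (rule ordIso_ordLeq_trans[OF card_of_Field_ordIso[OF l.card]])
  then obtain p where p: "inj_on p (Field lam)" "p ` Field lam \<subseteq> Q - D"
    unfolding card_of_ordLeq[symmetric] by blast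
  have "D \<noteq> {}"
  proof -
    obtain x where x: "x \<in> Field lam"
      using l.inf by fastforce
    obtain y where xy: "y \<in> Field lam" "x \<noteq> y"
      using infinite_Card_order_limit[OF l.card l.inf x] by blast
    then have "p x \<noteq> p y" "p x \<in> Q" "p y \<in> Q"
      using p x by (auto dest: inj_onD)
    then have "(p x, p y) \<in> ?R \<or> (p y, p x) \<in> ?R"
      using lex_linear by (auto simp: order_on_defs total_on_def)
    then show ?thesis
      using dense[of "p x" "p y"] dense[of "p y" "p x"] \<open>p x \<noteq> p y\<close> by auto
  qed
  then show ?thesis
    by (intro that[of Q ?R D p] lex_linear sc D_sub D_small p dense)
qed

section \<open>Positions\<close>

text \<open>
  Elements \<open>j\<close> of \<open>Field k\<close> serve as the ordinals below \<open>k\<close>, represented by \<open>underS k j\<close>.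
\<close>

definition has_type :: "'l rel \<Rightarrow> 'k rel \<Rightarrow> 'l set \<Rightarrow> 'k \<Rightarrow> bool" where
  "has_type l k b j \<longleftrightarrow> j \<in> Field k \<and>
     (\<exists>f. bij_betw f b (underS k j) \<and> (\<forall>x\<in>b. \<forall>y\<in>b. x \<in> underS l y \<longleftrightarrow> f x \<in> underS k (f y)))"

lemma has_type_restrict:
  assumes k: "Well_order k" and f: "bij_betw f b (underS k j)" "\<forall>x\<in>b. \<forall>y\<in>b. x \<in> underS l y \<longleftrightarrow> f x \<in> underS k (f y)"
    and x: "x \<in> b"
  shows "has_type l k (b \<inter> underS l x) (f x)"
  unfolding has_type_def
proof (intro conjI exI)
  have fx: "f x \<in> underS k j"
    using f(1) x by (auto simp: bij_betw_def)
  then show "f x \<in> Field k"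
    by (rule underS_imp_Field)
  have "f ` (b \<inter> underS l x) = underS k (f x)"
  proof
    show "f ` (b \<inter> underS l x) \<subseteq> underS k (f x)"
      using f(2) x by auto
    show "underS k (f x) \<subseteq> f ` (b \<inter> underS l x)"
    proof
      fix i assume i: "i \<in> underS k (f x)"
      then have "i \<in> underS k j"
        using fx by (rule underS_trans[OF k])
      then obtain y where "y \<in> b" "i = f y"
        using f(1) by (auto simp: bij_betw_def)
      then show "i \<in> f ` (b \<inter> underS l x)"
        using i f(2) x by auto
    qed
  qed
  then show "bij_betw f (b \<inter> underS l x) (underS k (f x))"
    using f(1) by (auto simp: bij_betw_def inj_on_def)
  show "\<forall>y\<in>b \<inter> underS l x. \<forall>z\<in>b \<inter> underS l x. y \<in> underS l z \<longleftrightarrow> f y \<in> underS k (f z)"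
    using f(2) by blast
qed

lemma has_type_unique:
  assumes l: "Well_order l" and k: "Well_order k" and b: "b \<subseteq> Field l"
    and "has_type l k b i" "has_type l k b j"
  shows "i = j"
proof -
  obtain f where f: "bij_betw f b (underS k i)" "\<And>x y. x \<in> b \<Longrightarrow> y \<in> b \<Longrightarrow> x \<in> underS l y \<longleftrightarrow> f x \<in> underS k (f y)"
    and iF: "i \<in> Field k"
    using assms(4) unfolding has_type_def by auto
  obtain g where g: "bij_betw g b (underS k j)" "\<And>x y. x \<in> b \<Longrightarrow> y \<in> b \<Longrightarrow> x \<in> underS l y \<longleftrightarrow> g x \<in> underS k (g y)"
    and jF: "j \<in> Field k"
    using assms(5) unfolding has_type_def by auto
  have fg: "x \<in> b \<longrightarrow> f x = g x" for x
  proof (induction x rule: wf_induct[of "l - Id"])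
    show "wf (l - Id)"
      using l by (simp add: well_order_on_def)
    fix x assume IH: "\<forall>y. (y, x) \<in> l - Id \<longrightarrow> y \<in> b \<longrightarrow> f y = g y"
    have IH: "f y = g y" if "y \<in> underS l x" "y \<in> b" for y
      using IH that by (auto simp: underS_def)
    show "x \<in> b \<longrightarrow> f x = g x"
    proof (intro impI, rule ccontr)
      assume x: "x \<in> b" and ne: "f x \<noteq> g x"
      have fx: "f x \<in> underS k i" and gx: "g x \<in> underS k j"
        using x f(1) g(1) by (auto simp: bij_betw_def)
      consider "f x \<in> underS k (g x)" | "g x \<in> underS k (f x)"
        using underS_linear[OF k underS_imp_Field(1)[OF fx] underS_imp_Field(1)[OF gx]] ne by blast
      then show False
      proof cases
        case 1
        then have "f x \<in> underS k j"
          using gx by (rule underS_trans[OF k])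
        then obtain y where y: "y \<in> b" "f x = g y"
          using g(1) by (auto simp: bij_betw_def)
        then have yx: "y \<in> underS l x"
          using g(2)[OF y(1) x] 1 by simp
        then have "f y = f x"
          using IH y by simp
        then show False
          using f(2)[OF y(1) x] yx underS_irrefl[of "f x" k] by simp
      next
        case 2
        then have "g x \<in> underS k i"
          using fx by (rule underS_trans[OF k])
        then obtain y where y: "y \<in> b" "g x = f y"
          using f(1) by (auto simp: bij_betw_def)
        then have yx: "y \<in> underS l x"
          using f(2)[OF y(1) x] 2 by simp
        then have "g y = g x"
          using IH y by simp
        then show False
          using g(2)[OF y(1) x] yx underS_irrefl[of "g x" k] by simp
      qed
    qed
  qed
  have "underS k i = f ` b" "underS k j = g ` b"
    using f(1) g(1) by (auto simp: bij_betw_def)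
  moreover have "f ` b = g ` b"
    using fg by (intro image_cong) auto
  ultimately have "underS k i = underS k j"
    by simp
  then show ?thesis
    using underS_linear[OF k iF jF] underS_irrefl[of i k] underS_irrefl[of j k] by auto
qed

definition position :: "'l rel \<Rightarrow> 'k rel \<Rightarrow> 'l set \<Rightarrow> 'l \<Rightarrow> 'k \<Rightarrow> bool" where
  "position l k b x j \<longleftrightarrow> x \<in> b \<and> has_type l k (b \<inter> underS l x) j"

definition consecutive :: "'l rel \<Rightarrow> 'l set \<Rightarrow> 'l \<Rightarrow> 'l \<Rightarrow> bool" where
  "consecutive l b x y \<longleftrightarrow> x \<in> b \<and> y \<in> b \<and> x \<in> underS l y \<and> (\<forall>z\<in>b. x \<in> underS l z \<longrightarrow> (y, z) \<in> l)"

locale two_orders =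
  fixes l :: "'l rel" and k :: "'k rel"
  assumes l: "Well_order l" and k: "Well_order k"
begin

lemma position_Field: "position l k b x j \<Longrightarrow> j \<in> Field k"
  by (auto simp: position_def has_type_def)

lemma position_unique:
  assumes "position l k b x i" "position l k b x j"
  shows "i = j"
  using has_type_unique[OF l k _ assms(1)[unfolded position_def, THEN conjunct2] assms(2)[unfolded position_def, THEN conjunct2]]
    underS_imp_Field(1)[of _ l x] by blast

lemma position_below:
  assumes "position l k b x j"
  shows position_less: "y \<in> b \<Longrightarrow> y \<in> underS l x \<Longrightarrow> \<exists>i\<in>underS k j. position l k b y i"
    and position_surj: "i \<in> underS k j \<Longrightarrow> \<exists>y\<in>underS l x. position l k b y i"
proof -
  obtain f where f: "bij_betw f (b \<inter> underS l x) (underS k j)"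
    "\<forall>y\<in>b \<inter> underS l x. \<forall>z\<in>b \<inter> underS l x. y \<in> underS l z \<longleftrightarrow> f y \<in> underS k (f z)"
    using assms unfolding position_def has_type_def by auto
  have pos: "position l k b y (f y)" if y: "y \<in> b \<inter> underS l x" for y
  proof -
    have "(b \<inter> underS l x) \<inter> underS l y = b \<inter> underS l y"
      using underS_trans[OF l] y by auto
    then show ?thesis
      using has_type_restrict[OF k f y] y by (simp add: position_def)
  qed
  show "\<exists>i\<in>underS k j. position l k b y i" if "y \<in> b" "y \<in> underS l x"
    using pos[of y] f(1) that by (auto simp: bij_betw_def)
  show "\<exists>y\<in>underS l x. position l k b y i" if "i \<in> underS k j"
  proof -
    have "i \<in> f ` (b \<inter> underS l x)"
      using f(1) that by (simp add: bij_betw_def)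
    then obtain y where "y \<in> b \<inter> underS l x" "i = f y"
      by blast
    then show ?thesis
      using pos by auto
  qed
qed

lemma position_less_iff:
  assumes "b \<subseteq> Field l" "position l k b x i" "position l k b y j"
  shows "x \<in> underS l y \<longleftrightarrow> i \<in> underS k j"
proof
  assume "x \<in> underS l y"
  then show "i \<in> underS k j"
    using position_less[OF assms(3), of x] position_unique[OF assms(2)] assms(2) by (auto simp: position_def)
next
  assume ij: "i \<in> underS k j"
  have xy: "x \<in> Field l" "y \<in> Field l" "x \<in> b" "y \<in> b"
    using assms by (auto simp: position_def)
  show "x \<in> underS l y"
  proof (rule ccontr)
    assume "x \<notin> underS l y"
    then consider "x = y" | "y \<in> underS l x"
      using underS_linear[OF l xy(1,2)] by blast
    then show False
    proof cases
      case 1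
      then show False
        using position_unique[of b x i j] assms(2,3) ij underS_irrefl[of i k] by auto
    next
      case 2
      then obtain m where "m \<in> underS k i" "position l k b y m"
        using position_less[OF assms(2) xy(4)] by blast
      then show False
        using position_unique[OF assms(3), of m] underS_asym[OF k ij] by blast
    qed
  qed
qed

lemma position_inj:
  assumes "b \<subseteq> Field l" "position l k b x j" "position l k b y j"
  shows "x = y"
  using position_less_iff[OF assms] position_less_iff[OF assms(1,3,2)] underS_irrefl[of j k]
    underS_linear[OF l, of x y] assms by (auto simp: position_def)

lemma consecutive_unique:
  assumes "consecutive l b x y" "consecutive l b x z"
  shows "y = z"
proof -
  have "(y, z) \<in> l" "(z, y) \<in> l"
    using assms by (auto simp: consecutive_def)
  moreover have "antisym l"
    using l by (simp add: order_on_defs)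
  ultimately show ?thesis
    by (auto dest: antisymD)
qed

lemma consecutive_exists:
  assumes "b \<subseteq> Field l" "x \<in> b" "z \<in> b" "x \<in> underS l z"
  obtains y where "consecutive l b x y"
proof -
  have sub: "{z \<in> b. x \<in> underS l z} \<subseteq> Field l" and ne: "{z \<in> b. x \<in> underS l z} \<noteq> {}"
    using assms by auto
  obtain y where "y \<in> {z \<in> b. x \<in> underS l z}" "\<And>z. z \<in> {z \<in> b. x \<in> underS l z} \<Longrightarrow> (y, z) \<in> l"
    by (rule least_exists[OF l sub ne], rule that)
  then show ?thesis
    using that[of y] assms(2) by (auto simp: consecutive_def)
qed

lemma all_positions:
  assumes a: "a \<subseteq> Field l" and card: "k \<le>o |a|" and j: "j \<in> Field k"
  obtains x where "position l k a x j"
proof -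
  let ?l = "Restr l a"
  have wa: "well_order_on a ?l"
    by (rule well_order_on_Restr[OF l a])
  then have Fa: "Field ?l = a" and Wa: "Well_order ?l"
    using well_order_on_Well_order[OF wa] by auto
  have "k \<le>o ?l"
    by (rule ordLeq_transitive[OF card card_of_least[OF wa]])
  then obtain f where f: "embed k ?l f"
    by (auto simp: ordLeq_def)
  have fa: "f j \<in> a"
    using embed_Field[OF f] j Fa by auto
  have "underS ?l (f j) = a \<inter> underS l (f j)"
    using fa by (auto simp: underS_def)
  then have bij: "bij_betw f (underS k j) (a \<inter> underS l (f j))"
    using embed_underS[OF k f j] by simp
  have mono: "f x \<in> underS l (f y)" if xy: "x \<in> underS k y" for x y
  proof -
    have "(f x, f y) \<in> ?l"
      using embed_compat[OF f] underS_imp_le[OF xy] by (auto simp: compat_def)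
    moreover have "f x \<noteq> f y"
      using inj_onD[OF embed_inj_on[OF k f]] underS_imp_Field[OF xy] xy underS_irrefl[of x k] by auto
    ultimately show ?thesis
      by (simp add: underS_def)
  qed
  have iff: "f x \<in> underS l (f y) \<longleftrightarrow> x \<in> underS k y" if "x \<in> Field k" "y \<in> Field k" for x y
    using mono[of x y] mono[of y x] underS_linear[OF k that] underS_asym[OF l, of "f x" "f y"]
      underS_irrefl[of "f x" l] by auto
  define g where "g = inv_into (underS k j) f"
  have g: "bij_betw g (a \<inter> underS l (f j)) (underS k j)"
    unfolding g_def by (rule bij_betw_inv_into[OF bij])
  have fg: "f (g x) = x" "g x \<in> underS k j" if "x \<in> a \<inter> underS l (f j)" for x
    using bij_betw_inv_into_right[OF bij that] bij_betwE[OF g] that by (auto simp: g_def)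
  have "has_type l k (a \<inter> underS l (f j)) j"
    unfolding has_type_def
  proof (intro conjI exI ballI)
    show "x \<in> underS l y \<longleftrightarrow> g x \<in> underS k (g y)"
      if "x \<in> a \<inter> underS l (f j)" "y \<in> a \<inter> underS l (f j)" for x y
      using iff[OF underS_imp_Field(1)[OF fg(2)[OF that(1)]] underS_imp_Field(1)[OF fg(2)[OF that(2)]]]
        fg(1)[OF that(1)] fg(1)[OF that(2)] by simp
  qed (use j g in auto)
  then show ?thesis
    using that[of "f j"] fa by (simp add: position_def)
qed

end

section \<open>Coding a set of positions\<close>

text \<open>
  Two points are near over \<open>S\<close> if they fill the same cut of \<open>S\<close>. A point of \<open>S\<close> is not near to
  anything in a linear order, itself included.
\<close>

definition near :: "'a rel \<Rightarrow> 'a set \<Rightarrow> 'a \<Rightarrow> 'a \<Rightarrow> bool" where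
  "near L S x y \<longleftrightarrow> (\<forall>z\<in>S. \<not> ((x, z) \<in> L \<and> (z, y) \<in> L) \<and> \<not> ((y, z) \<in> L \<and> (z, x) \<in> L))"

locale coding = two_orders l k for l :: "'l rel" and k :: "'k rel" +
  fixes Q :: "'q set" and R D and p :: "'l \<Rightarrow> 'q" and A :: "'k set" and c0
  assumes lin: "linear_order_on Q R" and D: "D \<subseteq> Q" and c0: "c0 \<in> D"
    and p: "p ` Field l \<subseteq> Q - D" "inj_on p (Field l)"
    and dense: "\<And>x y. (x, y) \<in> R \<Longrightarrow> x \<noteq> y \<Longrightarrow> \<exists>d\<in>D. (x, d) \<in> R \<and> (d, y) \<in> R"
    and A: "A \<subseteq> Field k"
    and limit: "\<And>j. j \<in> Field k \<Longrightarrow> \<exists>i\<in>Field k. j \<in> underS k i"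
begin

text \<open>
  The word of \<open>b\<close> has letters only at the positions in \<open>A\<close>. The letter at position \<open>j\<close> names the
  successor in \<open>b\<close> of the \<open>j\<close>-th point, so that it is revealed only when that successor is
  reached. Beyond the end of \<open>b\<close> the letter \<open>d\<close> is repeated; as \<open>D\<close> is dense, the words of one set
  \<open>b\<close> with all \<open>d\<close> in \<open>D\<close> separate all different continuations of \<open>b\<close>.
\<close>

definition entry :: "'l set \<Rightarrow> 'k \<Rightarrow> 'l \<Rightarrow> bool" where
  "entry b j y \<longleftrightarrow> (\<exists>x. consecutive l b x y \<and> position l k b x j)"

definition str :: "'l set \<Rightarrow> 'q \<Rightarrow> 'k \<Rightarrow> 'q" where
  "str b d j = (if j \<in> A then (if \<exists>y. entry b j y then p (SOME y. entry b j y) else d) else c0)"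

lemma entry_unique:
  assumes "b \<subseteq> Field l" "entry b j y" "entry b j z"
  shows "y = z"
proof -
  obtain u v where u: "consecutive l b u y" "position l k b u j"
    and v: "consecutive l b v z" "position l k b v j"
    using assms(2,3) unfolding entry_def by blast
  have "u = v"
    by (rule position_inj[OF assms(1) u(2) v(2)])
  then show ?thesis
    using consecutive_unique u(1) v(1) by blast
qed

lemma str_entry: "b \<subseteq> Field l \<Longrightarrow> j \<in> A \<Longrightarrow> entry b j y \<Longrightarrow> str b d j = p y"
  unfolding str_def using entry_unique[of b j] someI[of "entry b j" y] by auto

lemma str_no_entry: "j \<in> A \<Longrightarrow> \<not> (\<exists>y. entry b j y) \<Longrightarrow> str b d j = d"
  unfolding str_def by metis

lemma str_outside: "j \<notin> A \<Longrightarrow> str b d j = c0"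
  unfolding str_def by simp

lemma entry_mem: "entry b j y \<Longrightarrow> y \<in> b"
  by (auto simp: entry_def consecutive_def)

lemma entry_mono:
  assumes b: "b \<subseteq> Field l" and ij: "i \<in> underS k j" and y: "entry b j y"
  shows "\<exists>z. entry b i z"
proof -
  obtain x where x: "consecutive l b x y" "position l k b x j"
    using y unfolding entry_def by blast
  obtain u where u: "u \<in> underS l x" "position l k b u i"
    using position_surj[OF x(2) ij] by blast
  have "u \<in> b" "x \<in> b"
    using u(2) x(2) by (auto simp: position_def)
  then obtain z where "consecutive l b u z"
    by (rule consecutive_exists[OF b _ _ u(1)])
  then show ?thesis
    using u(2) unfolding entry_def by blast
qed

lemma str_mem:
  assumes "b \<subseteq> Field l" "d \<in> D"
  shows "str b d j \<in> Q"
proof (cases "j \<in> A \<and> (\<exists>y. entry b j y)")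
  case True
  then obtain y where y: "j \<in> A" "entry b j y"
    by blast
  then have "y \<in> Field l"
    using entry_mem assms(1) by blast
  then show ?thesis
    using str_entry[OF assms(1) y] p(1) by auto
next
  case False
  then have "str b d j = d \<or> str b d j = c0"
    unfolding str_def by auto
  then show ?thesis
    using assms(2) D c0 by auto
qed

lemma lex_space_str:
  assumes "M \<subseteq> {str b d | b d. b \<subseteq> Field l \<and> d \<in> D}"
  shows "lex_space k Q R M"
proof
  show "Well_order k" "linear_order_on Q R"
    by (rule k, rule lin)
  show "f i \<in> Q" if "f \<in> M" for f i
    using assms that str_mem by auto
  fix f g assume fg: "f \<in> M" "g \<in> M" "\<And>i. i \<in> Field k \<Longrightarrow> f i = g i"
  obtain b d b' d' where "f = str b d" "g = str b' d'"
    using assms fg(1,2) by blast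
  then show "f = g"
    using fg(3) A str_outside by (metis ext subsetD)
qed

lemma position_truncate:
  assumes b: "b \<subseteq> Field l" and x: "(x, c) \<in> l"
  shows "position l k (b \<inter> under l c) x j \<longleftrightarrow> position l k b x j"
proof -
  have "(b \<inter> under l c) \<inter> underS l x = b \<inter> underS l x"
    using le_trans_rel[OF l _ x] by (auto simp: under_def underS_def)
  then show ?thesis
    using x by (auto simp: position_def under_def)
qed

lemma consecutive_truncate:
  assumes b: "b \<subseteq> Field l" and c: "c \<in> b" and x: "x \<in> underS l c"
  shows "consecutive l (b \<inter> under l c) x y \<longleftrightarrow> consecutive l b x y"
proof
  assume y: "consecutive l (b \<inter> under l c) x y"
  have "(y, z) \<in> l" if z: "z \<in> b" "x \<in> underS l z" for z
  proof (cases "(z, c) \<in> l")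
    case True
    then show ?thesis
      using y z by (auto simp: consecutive_def under_def)
  next
    case False
    then have "(c, z) \<in> l"
      using not_le_iff[OF l, of z c] z(1) c b underS_imp_le[of c l z] by auto
    then show ?thesis
      using y le_trans_rel[OF l, of y c z] by (auto simp: consecutive_def under_def)
  qed
  then show "consecutive l b x y"
    using y by (auto simp: consecutive_def)
next
  assume "consecutive l b x y"
  then show "consecutive l (b \<inter> under l c) x y"
    using c x by (auto simp: consecutive_def under_def underS_def)
qed

lemma entry_truncate:
  assumes b: "b \<subseteq> Field l" and c: "position l k b c j"
  shows "entry (b \<inter> under l c) i y \<longleftrightarrow> entry b i y \<and> i \<in> underS k j"
proof
  have cb: "c \<in> b"
    using c by (simp add: position_def)
  assume "entry (b \<inter> under l c) i y"
  then obtain x where x: "consecutive l (b \<inter> under l c) x y" "position l k (b \<inter> under l c) x i"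
    unfolding entry_def by blast
  have xc: "x \<in> underS l c"
    using x(1) underS_le_trans[OF l, of x y c] by (auto simp: consecutive_def under_def)
  have pos: "position l k b x i"
    using x(2) position_truncate[OF b underS_imp_le[OF xc]] by simp
  have "consecutive l b x y"
    using x(1) consecutive_truncate[OF b cb xc] by simp
  moreover have "i \<in> underS k j"
    using position_less_iff[OF b pos c] xc by simp
  ultimately show "entry b i y \<and> i \<in> underS k j"
    using pos unfolding entry_def by blast
next
  have cb: "c \<in> b"
    using c by (simp add: position_def)
  assume i: "entry b i y \<and> i \<in> underS k j"
  then obtain x where x: "consecutive l b x y" "position l k b x i"
    unfolding entry_def by blast
  have xc: "x \<in> underS l c"
    using position_less_iff[OF b x(2) c] i by simp
  show "entry (b \<inter> under l c) i y"
    unfolding entry_def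
    using x consecutive_truncate[OF b cb xc] position_truncate[OF b underS_imp_le[OF xc]] by blast
qed

lemma str_truncate:
  assumes b: "b \<subseteq> Field l" and c: "position l k b c j" and i: "i \<in> A"
  shows str_truncate_below: "i \<in> underS k j \<Longrightarrow> entry b i y \<Longrightarrow> str (b \<inter> under l c) d i = str b d' i"
    and str_truncate_above: "i \<notin> underS k j \<Longrightarrow> str (b \<inter> under l c) d i = d"
proof -
  have sub: "b \<inter> under l c \<subseteq> Field l"
    using b by blast
  show "str (b \<inter> under l c) d i = str b d' i" if "i \<in> underS k j" "entry b i y"
    using str_entry[OF sub i] str_entry[OF b i] entry_truncate[OF b c] that by metis
  show "str (b \<inter> under l c) d i = d" if "i \<notin> underS k j"
    by (rule str_no_entry[OF i]) (use entry_truncate[OF b c] that in blast)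
qed

text \<open>
  The words with a given beginning form a convex set.
\<close>

lemma between_agree:
  assumes M: "lex_space k Q R M" "x \<in> M" "y \<in> M" "z \<in> M"
    and xy: "\<And>i. i \<in> underS k j \<Longrightarrow> x i = y i"
    and z: "(x, z) \<in> lex_fun k R M" "(z, y) \<in> lex_fun k R M" and i: "i \<in> underS k j"
  shows "z i = x i"
proof (rule ccontr)
  interpret lex_space k Q R M by (rule M(1))
  assume ne: "z i \<noteq> x i"
  then have zx: "z \<noteq> x"
    by auto
  obtain h where h: "h \<in> Field k" "z h \<noteq> x h" "\<And>g. g \<in> underS k h \<Longrightarrow> z g = x g"
    by (rule first_difference[OF M(4,2) zx], rule that)
  have "(h, i) \<in> k"
    using h(3)[of i] ne not_le_iff[OF k h(1) underS_imp_Field(1)[OF i]] by blast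
  then have hj: "h \<in> underS k j"
    by (rule le_underS_trans[OF k _ i])
  have "(x h, z h) \<in> R"
    using lex_less_iff[OF M(2,4) h(1)] h z(1) by auto
  moreover have "(z h, y h) \<in> R"
  proof -
    have "z g = y g" if "g \<in> underS k h" for g
      using h(3)[OF that] xy[OF underS_trans[OF k that hj]] by simp
    moreover have "z h \<noteq> y h"
      using h(2) xy[OF hj] by simp
    ultimately show ?thesis
      using lex_less_iff[OF M(4,3) h(1)] z(2) by auto
  qed
  ultimately show False
    using R_antisym h(2) xy[OF hj] by auto
qed

text \<open>
  Here \<open>S\<close> and \<open>T\<close> are the words that exist before stages \<open>\<beta>\<close> and \<open>\<gamma>\<close>. If \<open>j \<in> A\<close>, the letter of
  \<open>a\<close> at \<open>j\<close> is \<open>p \<beta>\<close>. No word in \<open>S\<close> contains it, hence \<open>S\<close> does not meet the convex set of the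
  words that continue \<open>a\<close> up to this letter, while \<open>T\<close> does. If \<open>j \<notin> A\<close>, the next letter of \<open>a\<close>
  after position \<open>j\<close> names a point that is at least \<open>\<gamma>\<close>, so it occurs in no word of \<open>T\<close>. Every
  word \<open>y\<close> of \<open>T\<close> thus branches off from \<open>a\<close> at a node that is complete at stage \<open>\<beta>\<close>, and there
  \<open>S\<close> contains \<open>y\<close> or, by density, a word strictly between; if the word of \<open>a\<close> has no further
  letter, \<open>y\<close> may also be this word itself, which then lies in \<open>S\<close>.
\<close>

lemma coded_bit:
  assumes M: "lex_space k Q R M" and a: "a \<subseteq> Field l" "k \<le>o |a|"
    and c1: "consecutive l a \<alpha> \<beta>" and c2: "consecutive l a \<beta> \<gamma>" and j: "position l k a \<alpha> j"
    and x: "str a d0 \<in> M" and SM: "S \<subseteq> M" and TM: "T \<subseteq> M"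
    and S: "S \<subseteq> {str b d | b d. b \<subseteq> underS l \<beta> \<and> d \<in> D}"
    and T: "T \<subseteq> {str b d | b d. b \<subseteq> underS l \<gamma> \<and> d \<in> D}"
    and Sin: "\<And>c d. c \<in> a \<Longrightarrow> c \<in> underS l \<beta> \<Longrightarrow> d \<in> D \<Longrightarrow> str (a \<inter> under l c) d \<in> S"
    and Tin: "\<And>c d. c \<in> a \<Longrightarrow> c \<in> underS l \<gamma> \<Longrightarrow> d \<in> D \<Longrightarrow> str (a \<inter> under l c) d \<in> T"
  shows "(\<exists>y\<in>T. near (lex_fun k R M) S y (str a d0)) \<longleftrightarrow> j \<in> A"
proof
  interpret lex_space k Q R M by (rule M)
  let ?x = "str a d0" and ?L = "lex_fun k R M"
  have ab: "\<alpha> \<in> a" "\<beta> \<in> a" "\<gamma> \<in> a" "\<alpha> \<in> underS l \<beta>" "\<beta> \<in> underS l \<gamma>"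
    using c1 c2 by (auto simp: consecutive_def)
  have jF: "j \<in> Field k"
    by (rule position_Field[OF j])
  \<comment> \<open>As \<open>a\<close> has at least \<open>k\<close> points, its word has no trailing \<open>d0\<close> at all.\<close>
  have entry_all: "\<exists>y. entry a i y" if i: "i \<in> Field k" for i
  proof -
    obtain u where u: "position l k a u i"
      by (rule all_positions[OF a i])
    obtain i' where i': "i' \<in> Field k" "i \<in> underS k i'"
      using limit[OF i] by blast
    obtain v where v: "position l k a v i'"
      by (rule all_positions[OF a i'(1)])
    have uv: "u \<in> a" "v \<in> a" "u \<in> underS l v"
      using u v position_less_iff[OF a(1) u v] i'(2) by (auto simp: position_def)
    obtain w where "consecutive l a u w"
      by (rule consecutive_exists[OF a(1) uv])
    then show ?thesis
      using u unfolding entry_def by blast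
  qed
  {
    assume jA: "j \<in> A"
    obtain j' where j': "j' \<in> Field k" "j \<in> underS k j'"
      using limit[OF jF] by blast
    obtain v where v: "position l k a v j'"
      by (rule all_positions[OF a j'(1)])
    have "v \<in> a" "\<alpha> \<in> underS l v"
      using v position_less_iff[OF a(1) j v] j'(2) by (auto simp: position_def)
    then have "(\<beta>, v) \<in> l"
      using c1 by (auto simp: consecutive_def)
    then obtain jb where jb: "position l k a \<beta> jb"
      using v position_less[OF v ab(2)] by (cases "\<beta> = v") (auto simp: underS_def)
    have jjb: "j \<in> underS k jb"
      using position_less_iff[OF a(1) j jb] ab(4) by simp
    let ?y = "str (a \<inter> under l \<beta>) c0"
    have yT: "?y \<in> T"
      by (rule Tin[OF ab(2,5) c0])
    have agree: "?y i = ?x i" if i: "i \<in> underS k jb" for i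
    proof (cases "i \<in> A")
      case True
      obtain y where "entry a i y"
        using entry_all[OF underS_imp_Field(1)[OF i]] by blast
      then show ?thesis
        by (rule str_truncate_below[OF a(1) jb True i])
    qed (simp add: str_outside)
    have xj: "?x j = p \<beta>"
      using c1 j by (intro str_entry[OF a(1) jA]) (auto simp: entry_def)
    have "near ?L S ?y ?x"
      unfolding near_def
    proof (intro ballI)
      fix z assume zS: "z \<in> S"
      have zM: "z \<in> M" and yM: "?y \<in> M"
        using zS SM yT TM by auto
      have "z j \<noteq> ?x j"
      proof -
        obtain b d where z: "z = str b d" "b \<subseteq> underS l \<beta>" "d \<in> D"
          using zS S by blast
        have bF: "b \<subseteq> Field l"
          using z(2) underS_imp_Field(1)[of _ l \<beta>] by blast
        have pF: "\<beta> \<in> Field l"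
          using ab(2) a(1) by blast
        show ?thesis
        proof (cases "\<exists>y. entry b j y")
          case True
          then obtain y where y: "entry b j y"
            by blast
          then have "y \<in> underS l \<beta>"
            using entry_mem z(2) by blast
          then have "y \<noteq> \<beta>" "y \<in> Field l"
            using underS_irrefl[of \<beta> l] underS_imp_Field(1)[of y l \<beta>] by auto
          then have "p y \<noteq> p \<beta>"
            using inj_onD[OF p(2) _ _ pF] by blast
          then show ?thesis
            using str_entry[OF bF jA y] z(1) xj by simp
        next
          case False
          then have "z j = d"
            using z(1) str_no_entry[OF jA] by simp
          then show ?thesis
            using xj z(3) p(1) pF by auto
        qed
      qed
      moreover have "z j = ?x j" if "(?y, z) \<in> ?L" "(z, ?x) \<in> ?L"
        using between_agree[OF M yM x zM agree that jjb] agree[OF jjb] by simp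
      moreover have "z j = ?x j" if "(?x, z) \<in> ?L" "(z, ?y) \<in> ?L"
        using between_agree[OF M x yM zM agree[symmetric] that jjb] by simp
      ultimately show "\<not> ((?y, z) \<in> ?L \<and> (z, ?x) \<in> ?L) \<and> \<not> ((?x, z) \<in> ?L \<and> (z, ?y) \<in> ?L)"
        by blast
    qed
    then show "\<exists>y\<in>T. near ?L S y ?x"
      using yT by blast
  }
  {
    assume "\<exists>y\<in>T. near ?L S y ?x"
    then obtain y where yT: "y \<in> T" and near: "near ?L S y ?x"
      by blast
    have yM: "y \<in> M"
      using yT TM by blast
    show "j \<in> A"
    proof (rule ccontr)
      assume jA: "j \<notin> A"
      obtain b d where y: "y = str b d" "b \<subseteq> underS l \<gamma>" "d \<in> D"
        using yT T by blast
      have bF: "b \<subseteq> Field l"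
        using y(2) underS_imp_Field(1)[of _ l \<gamma>] by blast
      have tot: "(y, ?x) \<in> ?L \<or> (?x, y) \<in> ?L"
        using lex_linear yM x by (cases "y = ?x") (auto simp: order_on_defs total_on_def refl_on_def)
      have refl: "(f, f) \<in> ?L" if "f \<in> M" for f
        using that by (simp add: lex_fun_def)
      have above: "?x i \<noteq> y i" if i: "i \<in> A" "j \<in> underS k i" for i
      proof -
        obtain v where v: "entry a i v"
          using entry_all A i(1) by blast
        then obtain u where u: "consecutive l a u v" "position l k a u i"
          unfolding entry_def by blast
        have "\<alpha> \<in> underS l u" "u \<in> a"
          using position_less_iff[OF a(1) j u(2)] i(2) u(2) by (auto simp: position_def)
        then have "(\<beta>, u) \<in> l"
          using c1 by (auto simp: consecutive_def)
        then have "\<beta> \<in> underS l v" "v \<in> a"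
          using u(1) le_underS_trans[OF l] by (auto simp: consecutive_def)
        then have gv: "(\<gamma>, v) \<in> l"
          using c2 by (auto simp: consecutive_def)
        have vF: "v \<in> Field l"
          using \<open>v \<in> a\<close> a(1) by blast
        have xi: "?x i = p v"
          by (rule str_entry[OF a(1) i(1) v])
        show ?thesis
        proof (cases "\<exists>y. entry b i y")
          case True
          then obtain w where w: "entry b i w"
            by blast
          then have wg: "w \<in> underS l \<gamma>"
            using entry_mem y(2) by blast
          then have "w \<in> underS l v"
            by (rule underS_le_trans[OF l _ gv])
          then have "w \<noteq> v" "w \<in> Field l"
            using underS_irrefl[of v l] underS_imp_Field(1)[of w l v] by auto
          then have "p w \<noteq> p v"
            using inj_onD[OF p(2) _ _ vF] by blast
          then show ?thesis
            using str_entry[OF bF i(1) w] y(1) xi by simp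
        next
          case False
          then have "y i = d"
            using y(1) str_no_entry[OF i(1)] by simp
          then show ?thesis
            using xi y(3) p(1) vF by auto
        qed
      qed
      show False
      proof (cases "y = ?x")
        case True
        have "str (a \<inter> under l \<alpha>) c0 i = ?x i" for i
        proof (cases "i \<in> A")
          case iA: True
          have iF: "i \<in> Field k"
            using iA A by blast
          have "i \<noteq> j"
            using iA jA by auto
          moreover have "j \<notin> underS k i"
            using above[OF iA] True by auto
          ultimately have ij: "i \<in> underS k j"
            using underS_linear[OF k iF jF] by blast
          obtain v where "entry a i v"
            using entry_all[OF iF] by blast
          then show ?thesis
            by (rule str_truncate_below[OF a(1) j iA ij])
        qed (simp add: str_outside)
        then have "str (a \<inter> under l \<alpha>) c0 = ?x"
          by (rule HOL.ext)
        then have "?x \<in> S"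
          using Sin[OF ab(1,4) c0] by simp
        then show False
          using near refl[OF x] True unfolding near_def by auto
      next
        case False
        then have ne: "?x \<noteq> y"
          by auto
        obtain i where i: "i \<in> Field k" "?x i \<noteq> y i" "\<And>h. h \<in> underS k i \<Longrightarrow> ?x h = y h"
          by (rule first_difference[OF x yM ne], rule that)
        have iA: "i \<in> A"
          using i(2) y(1) str_outside by (cases "i \<in> A") auto
        have "i \<noteq> j"
          using iA jA by auto
        obtain v where v: "entry a i v"
          using entry_all[OF i(1)] by blast
        obtain u where u: "consecutive l a u v" "position l k a u i"
          using v unfolding entry_def by blast
        have vF: "v \<in> Field l"
          using entry_mem[OF v] a(1) by blast
        have xi: "?x i = p v"
          by (rule str_entry[OF a(1) iA v])
        \<comment> \<open>The truncation at \<open>c\<close> agrees with \<open>a\<close> before \<open>i\<close> and is free to continue from \<open>i\<close> on.\<close>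
        have "\<exists>c i0. c \<in> a \<and> c \<in> underS l \<beta> \<and> position l k a c i0 \<and> (i0, i) \<in> k \<and>
          (\<forall>h\<in>A. h \<in> underS k i \<longrightarrow> h \<in> underS k i0)"
        proof (cases "i \<in> underS k j")
          case True
          have "u \<in> underS l \<alpha>" "u \<in> a"
            using position_less_iff[OF a(1) u(2) j] True u(2) by (auto simp: position_def)
          then show ?thesis
            using u(2) underS_trans[OF l _ ab(4)] le_refl_Field[OF k i(1)] by blast
        next
          case nj: False
          then have ji: "j \<in> underS k i"
            using underS_linear[OF k i(1) jF] \<open>i \<noteq> j\<close> by blast
          have "h \<in> underS k j" if h: "h \<in> A" "h \<in> underS k i" for h
          proof -
            have "j \<notin> underS k h" "h \<noteq> j"
              using above[OF h(1)] i(3)[OF h(2)] h(1) jA by auto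
            then show ?thesis
              using underS_linear[OF k underS_imp_Field(1)[OF h(2)] jF] by blast
          qed
          then show ?thesis
            using ab(1,4) j underS_imp_le[OF ji] by blast
        qed
        then obtain c i0 where c: "c \<in> a" "c \<in> underS l \<beta>" "position l k a c i0" "(i0, i) \<in> k"
          and below: "\<And>h. h \<in> A \<Longrightarrow> h \<in> underS k i \<Longrightarrow> h \<in> underS k i0"
          by blast
        define m where "m d' = str (a \<inter> under l c) d'" for d'
        have mS: "m d' \<in> S" if "d' \<in> D" for d'
          unfolding m_def by (rule Sin[OF c(1,2) that])
        have m_below: "m d' h = ?x h" if h: "h \<in> underS k i" for h d'
        proof (cases "h \<in> A")
          case True
          obtain w where "entry a h w"
            using entry_all[OF underS_imp_Field(1)[OF h]] by blast
          then show ?thesis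
            unfolding m_def by (rule str_truncate_below[OF a(1) c(3) True below[OF True h]])
        qed (simp add: str_outside m_def)
        have m_above: "m d' h = d'" if h: "h \<in> A" "(i, h) \<in> k" for h d'
        proof -
          have "h \<notin> underS k i0"
          proof
            assume "h \<in> underS k i0"
            then have "h \<in> underS k i"
              by (rule underS_le_trans[OF k _ c(4)])
            then show False
              using not_le_iff[OF k i(1) underS_imp_Field(1)] h(2) by blast
          qed
          then show ?thesis
            unfolding m_def by (rule str_truncate_above[OF a(1) c(3) h(1)])
        qed
        have ii: "(i, i) \<in> k"
          by (rule le_refl_Field[OF k i(1)])
        show False
        proof (cases "\<exists>w. entry b i w")
          case no: False
          have "m d h = y h" for h
          proof (cases "h \<in> A \<and> (i, h) \<in> k")
            case True
            have "\<not> (\<exists>w. entry b h w)"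
            proof
              assume "\<exists>w. entry b h w"
              then obtain w where w: "entry b h w"
                by blast
              then have "\<exists>w. entry b i w"
                using entry_mono[OF bF _ w] True by (cases "h = i") (auto simp: underS_def)
              then show False
                using no by blast
            qed
            then show ?thesis
              using True m_above[of h d] y(1) str_no_entry[of h b d] by simp
          next
            case nn: False
            show ?thesis
            proof (cases "h \<in> A")
              case True
              then have "h \<in> underS k i"
                using nn not_le_iff[OF k i(1), of h] A by blast
              then show ?thesis
                using m_below i(3) by simp
            qed (simp add: m_def y(1) str_outside)
          qed
          then have "m d = y"
            by (rule HOL.ext)
          then have "y \<in> S"
            using mS[OF y(3)] by simp
          then show False
            using near tot refl[OF yM] unfolding near_def by auto
        next
          case True
          then obtain w where w: "entry b i w"
            by blast
          have yi: "y i = p w"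
            using str_entry[OF bF iA w] y(1) by simp
          have wF: "w \<in> Field l"
            using entry_mem[OF w] bF by blast
          have nD: "p v \<notin> D" "p w \<notin> D"
            using p(1) vF wF by auto
          have between: "(f, m d') \<in> ?L \<and> (m d', g) \<in> ?L"
            if fg: "f \<in> M" "g \<in> M" "\<And>h. h \<in> underS k i \<Longrightarrow> f h = ?x h" "\<And>h. h \<in> underS k i \<Longrightarrow> g h = ?x h"
              and d': "d' \<in> D" "(f i, d') \<in> R" "(d', g i) \<in> R" "f i \<notin> D" "g i \<notin> D" for f g d'
          proof -
            have mM: "m d' \<in> M" and mi: "m d' i = d'"
              using mS[OF d'(1)] SM m_above[OF iA ii] by auto
            show ?thesis
              by (intro conjI lexI[OF fg(1) mM i(1)] lexI[OF mM fg(2) i(1)])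
                (use fg m_below mi d' in auto)
          qed
          have "(?x i, y i) \<in> R \<or> (y i, ?x i) \<in> R"
            by (rule R_total[OF val[OF x i(1)] val[OF yM i(1)] i(2)])
          then show False
          proof
            assume "(?x i, y i) \<in> R"
            then obtain d' where d': "d' \<in> D" "(?x i, d') \<in> R" "(d', y i) \<in> R"
              using dense i(2) by blast
            have "(?x, m d') \<in> ?L \<and> (m d', y) \<in> ?L"
              by (rule between[OF x yM _ _ d']) (use i(3) nD xi yi in auto)
            then show False
              using near mS[OF d'(1)] unfolding near_def by blast
          next
            assume "(y i, ?x i) \<in> R"
            then obtain d' where d': "d' \<in> D" "(y i, d') \<in> R" "(d', ?x i) \<in> R"
              using dense[of "y i" "?x i"] i(2) by auto
            have "(y, m d') \<in> ?L \<and> (m d', ?x) \<in> ?L"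
              by (rule between[OF yM x _ _ d']) (use i(3) nD xi yi in auto)
            then show False
              using near mS[OF d'(1)] unfolding near_def by blast
          qed
        qed
      qed
    qed
  }
qed

end

section \<open>Embeddings preserve the coded bits\<close>

lemma near_sym: "near L S x y \<Longrightarrow> near L S y x"
  unfolding near_def by blast

lemma near_trans:
  assumes lin: "linear_order_on A r" and S: "S \<subseteq> A" and y: "y \<in> A"
    and xy: "near r S x y" and yz: "near r S y z"
  shows "near r S x z"
  unfolding near_def
proof (intro ballI)
  fix s assume s: "s \<in> S"
  have "(s, y) \<in> r \<or> (y, s) \<in> r"
    using lin S s y by (cases "s = y") (auto simp: order_on_defs total_on_def refl_on_def)
  then show "\<not> ((x, s) \<in> r \<and> (s, z) \<in> r) \<and> \<not> ((z, s) \<in> r \<and> (s, x) \<in> r)"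
    using xy yz s unfolding near_def by blast
qed

text \<open>
  Let \<open>b\<close> and \<open>c\<close> be closure points for the choices made in the proof. If \<open>w\<close> in \<open>A\<close> is of rank
  less than \<open>b\<close> and lies between \<open>f u\<close> and \<open>f v\<close>, then the points sent below \<open>w\<close> have a cofinal
  set \<open>K w\<close> of size less than \<open>lam\<close>, hence of ranks below \<open>b\<close>, and some point of \<open>K w\<close> lies
  between \<open>u\<close> and \<open>v\<close>. So \<open>f\<close> preserves nearness, and it maps witnesses before \<open>c\<close> to witnesses
  before \<open>c\<close>. In the other direction, a point \<open>w\<close> of rank less than \<open>c\<close> that is near to \<open>f x\<close> is
  near to the image of some point of \<open>M\<close>, and such a point \<open>wit w b\<close> has been chosen depending on
  \<open>w\<close> and \<open>b\<close> only, so it has rank less than \<open>c\<close>.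
\<close>

lemma embedding_preserves_bits:
  fixes lam :: "'l rel" and N :: "'l \<Rightarrow> 'm set" and A :: "'a set" and f :: "'m \<Rightarrow> 'a" and h :: "'a \<Rightarrow> 'l"
  defines "Mlt b \<equiv> \<Union>e\<in>underS lam b. N e" and "Alt b \<equiv> {z \<in> A. h z \<in> underS lam b}"
  assumes lam: "uncountable_regular lam" and N: "\<And>e. e \<in> Field lam \<Longrightarrow> |N e| <o lam"
    and M: "M = (\<Union>e\<in>Field lam. N e)" and L: "linear_order_on M L" and sc: "small_cofinality lam M L"
    and r: "linear_order_on A r" and f: "order_embedding_on f M L A r"
    and h: "inj_on h A" "h ` A \<subseteq> Field lam"
  obtains G where "\<And>x. x \<in> Field lam \<Longrightarrow> G x \<in> Field lam"
    and "\<And>b c x. b \<in> closure_points lam G \<Longrightarrow> c \<in> closure_points lam G \<Longrightarrow> b \<in> underS lam c \<Longrightarrow> x \<in> M \<Longrightarrow>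
      (\<exists>y\<in>Mlt c. near L (Mlt b) y x) \<longleftrightarrow> (\<exists>w\<in>Alt c. near r (Alt b) w (f x))"
proof -
  interpret l: uncountable_regular lam by (rule lam)
  have fA: "f m \<in> A" if "m \<in> M" for m
    using f that by (auto simp: order_embedding_on_def)
  have fr: "(f m, f m') \<in> r" if "(m, m') \<in> L" for m m'
    using f that L unfolding order_embedding_on_def order_on_defs by blast
  have r_trans: "(x, z) \<in> r" if "(x, y) \<in> r" "(y, z) \<in> r" for x y z
    using r that by (auto simp: order_on_defs dest: transD)
  have rf: "(m, m') \<in> L" if "m \<in> M" "m' \<in> M" "(f m, f m') \<in> r" for m m'
  proof (rule ccontr)
    assume n: "(m, m') \<notin> L"
    then have ne: "m \<noteq> m'"
      using L that(1) by (auto simp: order_on_defs refl_on_def)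
    then have "(m', m) \<in> L"
      using L n that(1,2) by (auto simp: order_on_defs total_on_def)
    then have "f m = f m'"
      using fr that(3) r by (auto simp: order_on_defs dest: antisymD)
    then show False
      using f that(1,2) ne by (auto simp: order_embedding_on_def dest: inj_onD)
  qed
  have "\<exists>e. m \<in> M \<longrightarrow> e \<in> Field lam \<and> m \<in> N e" for m
    using M by blast
  then obtain rk where rk: "\<And>m. m \<in> M \<Longrightarrow> rk m \<in> Field lam" "\<And>m. m \<in> M \<Longrightarrow> m \<in> N (rk m)"
    by metis
  have "\<exists>K. K \<subseteq> {m \<in> M. (f m, w) \<in> r} \<and> |K| <o lam \<and> (\<forall>x\<in>{m \<in> M. (f m, w) \<in> r}. \<exists>y\<in>K. (x, y) \<in> L)" for w
    by (rule sc[unfolded small_cofinality_def, rule_format]) blast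
  then have "\<forall>w. \<exists>K. K \<subseteq> {m \<in> M. (f m, w) \<in> r} \<and> |K| <o lam \<and> (\<forall>x\<in>{m \<in> M. (f m, w) \<in> r}. \<exists>y\<in>K. (x, y) \<in> L)"
    by blast
  from choice[OF this] obtain K where "\<forall>w. K w \<subseteq> {m \<in> M. (f m, w) \<in> r} \<and> |K w| <o lam \<and>
      (\<forall>x\<in>{m \<in> M. (f m, w) \<in> r}. \<exists>y\<in>K w. (x, y) \<in> L)"
    by blast
  then have K: "\<And>w. K w \<subseteq> {m \<in> M. (f m, w) \<in> r}" "\<And>w. |K w| <o lam"
    "\<And>w x. x \<in> M \<Longrightarrow> (f x, w) \<in> r \<Longrightarrow> \<exists>y\<in>K w. (x, y) \<in> L"
    by blast+
  define wit where "wit w b = (SOME m. m \<in> M \<and> near r (Alt b) (f m) w)" for w b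
  have wit: "wit w b \<in> M" "near r (Alt b) (f (wit w b)) w" if "m \<in> M" "near r (Alt b) (f m) w" for w b m
    unfolding wit_def using someI[of "\<lambda>m. m \<in> M \<and> near r (Alt b) (f m) w" m] that by auto
  define v where "v = inv_into A h"
  have v: "v (h z) = z" if "z \<in> A" for z
    unfolding v_def by (rule inv_into_f_f[OF h(1) that])
  define Z where "Z e = (h ` f ` N e \<union> rk ` K (v e) \<union>
    (\<lambda>(a, b). rk (wit (v a) b)) ` (under lam e \<times> under lam e)) \<inter> Field lam" for e
  have Z_sub: "Z e \<subseteq> Field lam" for e
    by (simp add: Z_def)
  have Z_small: "|Z e| <o lam" if "e \<in> Field lam" for e
    unfolding Z_def
    by (rule l.small_subset[OF _ Int_lower1])
      (intro l.small_Un l.small_image l.small_Times l.small_under N[OF that] K(2))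
  have "\<exists>u. e \<in> Field lam \<longrightarrow> u \<in> Field lam \<and> Z e \<subseteq> underS lam u" for e
  proof (cases "e \<in> Field lam")
    case True
    obtain u where "u \<in> Field lam" "Z e \<subseteq> underS lam u"
      by (rule l.small_bounded[OF Z_sub Z_small[OF True]])
    then show ?thesis
      by blast
  qed simp
  then obtain G where G: "\<And>e. e \<in> Field lam \<Longrightarrow> G e \<in> Field lam"
    "\<And>e. e \<in> Field lam \<Longrightarrow> Z e \<subseteq> underS lam (G e)"
    by metis
  have below: "z \<in> underS lam b" if b: "b \<in> closure_points lam G" and e: "e \<in> underS lam b" "z \<in> Z e" for b e z
    by (rule underS_trans[OF l.wo subsetD[OF G(2)[OF underS_imp_Field(1)[OF e(1)]] e(2)] closure_pointsD(1)[OF b e(1)]])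
  have Mlt_M: "Mlt b \<subseteq> M" for b
    unfolding Mlt_def M using underS_imp_Field(1)[of _ lam b] by blast
  have f_lt: "f m \<in> Alt b" if b: "b \<in> closure_points lam G" and m: "m \<in> Mlt b" for b m
  proof -
    obtain e where e: "e \<in> underS lam b" "m \<in> N e"
      using m unfolding Mlt_def by blast
    have mA: "f m \<in> A"
      using fA Mlt_M m by blast
    then have "h (f m) \<in> Z e"
      unfolding Z_def using e(2) h(2) by blast
    then show ?thesis
      unfolding Alt_def using mA below[OF b e(1)] by blast
  qed
  have rk_lt: "m \<in> Mlt b" if "m \<in> M" "rk m \<in> underS lam b" for m b
    unfolding Mlt_def using rk(2)[OF that(1)] that(2) by blast
  have mid: "\<exists>m\<in>Mlt b. (u, m) \<in> L \<and> (m, w) \<in> L"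
    if b: "b \<in> closure_points lam G" and uw: "u \<in> M" "w \<in> M" and z: "z \<in> Alt b" "(f u, z) \<in> r" "(z, f w) \<in> r" for b u w z
  proof -
    obtain m where m: "m \<in> K z" "(u, m) \<in> L"
      using K(3)[OF uw(1) z(2)] by blast
    have mM: "m \<in> M" and mz: "(f m, z) \<in> r"
      using K(1)[of z] m(1) by auto
    have "(m, w) \<in> L"
      by (rule rf[OF mM uw(2) r_trans[OF mz z(3)]])
    moreover have "rk m \<in> Z (h z)"
      unfolding Z_def using m(1) v[of z] z(1) rk(1)[OF mM] by (auto simp: Alt_def)
    then have "m \<in> Mlt b"
      using rk_lt[OF mM] below[OF b] z(1) by (auto simp: Alt_def)
    ultimately show ?thesis
      using m(2) by blast
  qed
  have main: "(\<exists>y\<in>Mlt c. near L (Mlt b) y x) \<longleftrightarrow> (\<exists>w\<in>Alt c. near r (Alt b) w (f x))"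
    if b: "b \<in> closure_points lam G" and c: "c \<in> closure_points lam G" and bc: "b \<in> underS lam c" and x: "x \<in> M" for b c x
  proof
    assume "\<exists>y\<in>Mlt c. near L (Mlt b) y x"
    then obtain y where y: "y \<in> Mlt c" "near L (Mlt b) y x"
      by blast
    have yM: "y \<in> M"
      using y(1) Mlt_M by blast
    have "near r (Alt b) (f y) (f x)"
      unfolding near_def using mid[OF b yM x] mid[OF b x yM] y(2) unfolding near_def by blast
    then show "\<exists>w\<in>Alt c. near r (Alt b) w (f x)"
      using f_lt[OF c y(1)] by blast
  next
    assume "\<exists>w\<in>Alt c. near r (Alt b) w (f x)"
    then obtain w where w: "w \<in> Alt c" "near r (Alt b) w (f x)"
      by blast
    define m where "m = wit w b"
    have mM: "m \<in> M" and mw: "near r (Alt b) (f m) w"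
      using wit[OF x near_sym[OF w(2)]] by (auto simp: m_def)
    have wA: "w \<in> A" "h w \<in> underS lam c"
      using w(1) by (auto simp: Alt_def)
    obtain e where e: "e \<in> underS lam c" "h w \<in> under lam e" "b \<in> under lam e"
      using underS_directed[OF l.wo wA(2) bc] by blast
    have "rk m \<in> Z e"
      unfolding Z_def
    proof (intro IntI UnI2)
      show "rk m \<in> (\<lambda>(a, b). rk (wit (v a) b)) ` (under lam e \<times> under lam e)"
        by (rule image_eqI[of _ _ "(h w, b)"]) (use e(2,3) v[OF wA(1)] in \<open>simp_all add: m_def\<close>)
    qed (rule rk(1)[OF mM])
    then have "m \<in> Mlt c"
      by (intro rk_lt[OF mM] below[OF c e(1)])
    moreover have fx: "near r (Alt b) (f m) (f x)"
      by (rule near_trans[OF r _ wA(1) mw w(2)]) (auto simp: Alt_def)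
    then have "near L (Mlt b) m x"
      unfolding near_def using fr f_lt[OF b] by blast
    ultimately show "\<exists>y\<in>Mlt c. near L (Mlt b) y x"
      by blast
  qed
  show ?thesis
    by (rule that[of G, OF G(1) main])
qed

section \<open>Non-existence of universal orders\<close>

text \<open>
  The bit of \<open>z\<close> at position \<open>j\<close> says whether the cut filled by \<open>z\<close> over the points of rank less
  than \<open>\<beta>\<close> is already filled before stage \<open>\<gamma>\<close>. Both stages are read off from \<open>a\<close> alone, so that
  \<open>lam\<close> many sets \<open>a\<close> and points \<open>z\<close> give only \<open>lam\<close> many sets of bits.
\<close>

definition read_bits :: "'l rel \<Rightarrow> 'k rel \<Rightarrow> 'a set \<Rightarrow> 'a rel \<Rightarrow> ('a \<Rightarrow> 'l) \<Rightarrow> 'l set \<Rightarrow> 'a \<Rightarrow> 'k set" where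
  "read_bits l k A r h a z = {j. \<exists>\<alpha> \<beta> \<gamma>. consecutive l a \<alpha> \<beta> \<and> consecutive l a \<beta> \<gamma> \<and>
     position l k a \<alpha> j \<and>
     (\<exists>w\<in>{w \<in> A. h w \<in> underS l \<gamma>}. near r {w \<in> A. h w \<in> underS l \<beta>} w z)}"

lemma Pow_ordIso_ctwo_cexp: "|Pow (Field k)| =o ctwo ^c k"
  unfolding ctwo_def cexp_def Field_card_of by (rule card_of_Pow_Func)

theorem mainTheorem11:
  fixes lam :: "'l rel" and \<kappa> :: "'k rel"
  assumes "Card_order lam" and "regularCard lam"
    and "Card_order \<kappa>" and "cinfinite \<kappa>"
    and "cardSuc \<kappa> <o lam" and "lam <o ctwo ^c \<kappa>"
  shows "\<not> (\<exists>(A :: 'a set) r. universal_linear_order lam A r)"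
proof
  assume "\<exists>(A :: 'a set) r. universal_linear_order lam A r"
  then obtain A :: "'a set" and r where univ: "universal_linear_order lam A r"
    by blast
  have \<kappa>lam: "\<kappa> <o lam"
    by (rule ordLess_transitive[OF cardSuc_greater[OF assms(3)] assms(5)])
  have lam: "uncountable_regular lam"
    by standard (use assms ordLeq_ordLess_trans[OF natLeq_ordLeq_cinfinite \<kappa>lam] in simp_all)
  interpret l: uncountable_regular lam by (rule lam)
  have lamPow: "lam <o |Pow (Field \<kappa>)|"
    by (rule ordLess_ordIso_trans[OF assms(6) ordIso_symmetric[OF Pow_ordIso_ctwo_cexp]])
  have \<kappa>wo: "Well_order \<kappa>"
    using assms(3) by (rule card_order_on_well_order_on)
  have \<kappa>small: "|Field \<kappa>| <o lam"
    by (rule ordIso_ordLess_trans[OF card_of_Field_ordIso[OF assms(3)] \<kappa>lam])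
  have r: "linear_order_on A r" and A: "|A| =o lam"
    using univ by (simp_all add: universal_linear_order_def)
  have "|A| \<le>o |Field lam|"
    by (rule ordIso_ordLeq_trans[OF A ordIso_imp_ordLeq[OF ordIso_symmetric[OF card_of_Field_ordIso[OF l.card]]]])
  then obtain h where h: "inj_on h A" "h ` A \<subseteq> Field lam"
    unfolding card_of_ordLeq[symmetric] by blast
  obtain BB where BB: "approachable_guessing \<kappa> lam BB"
    using approachable_guessing_exists[OF lam assms(3,4,5)] by blast
  then have BB_small: "|BB e| <o lam" if "e \<in> Field lam" for e
    using that by (simp add: approachable_guessing_def)

  \<comment> \<open>Choose a set of positions that is read off from no guess and no point of the universal
    order.\<close>
  define BA where "BA = (\<Union>e\<in>Field lam. BB e)"
  have BA_card: "|BA| \<le>o lam"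
    unfolding BA_def
    by (rule card_of_UNION_ordLeq_infinite_Field[OF l.inf l.card])
      (use card_of_Field_ordIso[OF l.card] BB_small in \<open>auto intro: ordIso_imp_ordLeq ordLess_imp_ordLeq\<close>)
  have "|(\<lambda>(a, z). read_bits lam \<kappa> A r h a z) ` (BA \<times> A)| \<le>o lam"
    by (rule ordLeq_transitive[OF card_of_image
          card_of_Times_ordLeq_infinite_Field[OF l.inf BA_card ordIso_imp_ordLeq[OF A] l.card]])
  then have "|(\<lambda>(a, z). read_bits lam \<kappa> A r h a z) ` (BA \<times> A)| <o |Pow (Field \<kappa>)|"
    by (rule ordLeq_ordLess_trans[OF _ lamPow])
  then have "\<not> Pow (Field \<kappa>) \<subseteq> (\<lambda>(a, z). read_bits lam \<kappa> A r h a z) ` (BA \<times> A)"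
    using card_of_mono1[of "Pow (Field \<kappa>)"] not_ordLess_ordLeq by (metis (no_types))
  then obtain X where X: "X \<subseteq> Field \<kappa>" and X_new: "\<And>a z. a \<in> BA \<Longrightarrow> z \<in> A \<Longrightarrow> X \<noteq> read_bits lam \<kappa> A r h a z"
    by auto

  obtain Q :: "('k \<Rightarrow> bool) set" and R D p where Q: "linear_order_on Q R" "small_cofinality lam Q R"
    and DQ: "D \<subseteq> Q" "|D| <o lam" "D \<noteq> {}" and pQ: "p ` Field lam \<subseteq> Q - D" "inj_on p (Field lam)"
    and denseR: "\<And>f g. (f, g) \<in> R \<Longrightarrow> f \<noteq> g \<Longrightarrow> \<exists>d\<in>D. (f, d) \<in> R \<and> (d, g) \<in> R"
    by (rule dense_order[OF lam assms(3) \<kappa>lam ordLess_imp_ordLeq[OF lamPow]], rule that)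
  obtain c0 where c0D: "c0 \<in> D"
    using DQ(3) by blast
  interpret coding lam \<kappa> Q R D p X c0
  proof
    show "\<exists>i\<in>Field \<kappa>. j \<in> underS \<kappa> i" if "j \<in> Field \<kappa>" for j
      using infinite_Card_order_limit[OF assms(3) _ that] assms(4)
      by (auto simp: underS_def cinfinite_def)
  qed (rule l.wo \<kappa>wo Q(1) DQ(1) c0D pQ X denseR; assumption)+

  \<comment> \<open>Stage \<open>e\<close> of the filtration of the coding order: \<open>B e\<close> also contains the listed sets with one
    more point, as truncations include their last point.\<close>
  define B where "B e = (\<Union>i\<in>under lam e. BB i) \<union>
    (\<lambda>(v, b). insert v b) ` (under lam e \<times> (\<Union>i\<in>under lam e. BB i))" for e
  define N where "N e = (\<lambda>(b, d). str b d) ` ({b \<in> B e. b \<subseteq> under lam e} \<times> D)" for e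
  define M where "M = (\<Union>e\<in>Field lam. N e)"
  define L where "L = lex_fun \<kappa> R M"
  have B0_small: "|\<Union>i\<in>under lam e. BB i| <o lam" for e
    by (rule l.small_UN[OF l.small_under BB_small]) (auto simp: under_def Field_def)
  have B_small: "|B e| <o lam" for e
    unfolding B_def by (intro l.small_Un l.small_image l.small_Times l.small_under B0_small)
  have N_small: "|N e| <o lam" for e
    unfolding N_def
    by (intro l.small_image l.small_Times DQ(2) l.small_subset[OF B_small[of e]]) auto
  have N_sub: "N e \<subseteq> {str b d | b d. b \<subseteq> under lam e \<and> d \<in> D}" for e
    unfolding N_def by auto
  have M_sub: "M \<subseteq> {str b d | b d. b \<subseteq> Field lam \<and> d \<in> D}"
    unfolding M_def using N_sub by (fastforce simp: under_def Field_def)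
  have lexM: "lex_space \<kappa> Q R M"
    by (rule lex_space_str[OF M_sub])
  have L: "linear_order_on M L"
    unfolding L_def by (rule lex_space.lex_linear[OF lexM])
  have sc: "small_cofinality lam M L"
    unfolding L_def by (rule small_cofinality_lex[OF lexM lam \<kappa>small Q(2)])
  have M_card: "|M| \<le>o lam"
    unfolding M_def
    by (rule card_of_UNION_ordLeq_infinite_Field[OF l.inf l.card])
      (use card_of_Field_ordIso[OF l.card] N_small in \<open>auto intro: ordIso_imp_ordLeq ordLess_imp_ordLeq\<close>)
  obtain f where f: "order_embedding_on f M L A r"
    using universal_linear_order_embeds[OF assms(1) univ L M_card] by blast
  let ?Mlt = "\<lambda>b. \<Union>e\<in>underS lam b. N e" and ?Alt = "\<lambda>b. {w \<in> A. h w \<in> underS lam b}"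
  obtain G where G: "\<And>x. x \<in> Field lam \<Longrightarrow> G x \<in> Field lam"
    and bits: "\<And>b c x. b \<in> closure_points lam G \<Longrightarrow> c \<in> closure_points lam G \<Longrightarrow> b \<in> underS lam c \<Longrightarrow> x \<in> M \<Longrightarrow>
      (\<exists>y\<in>?Mlt c. near L (?Mlt b) y x) \<longleftrightarrow> (\<exists>w\<in>?Alt c. near r (?Alt b) w (f x))"
    by (rule embedding_preserves_bits[OF lam N_small M_def L sc r f h], rule that)
  have "\<exists>e\<in>Field lam. \<exists>a\<in>BB e. a \<subseteq> closure_points lam G \<and> \<kappa> \<le>o |a| \<and> |a| <o lam \<and>
      (\<forall>x\<in>a. \<forall>y\<in>a. x \<in> underS lam y \<longrightarrow> (\<exists>e\<in>underS lam y. a \<inter> underS lam x \<in> BB e))"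
    using BB[unfolded approachable_guessing_def, THEN conjunct2, THEN spec, of G] G by simp
  then obtain e0 a where e0: "e0 \<in> Field lam" and a: "a \<in> BB e0" "a \<subseteq> closure_points lam G" "\<kappa> \<le>o |a|" "|a| <o lam"
    and approach: "\<And>x y. x \<in> a \<Longrightarrow> y \<in> a \<Longrightarrow> x \<in> underS lam y \<Longrightarrow> \<exists>e\<in>underS lam y. a \<inter> underS lam x \<in> BB e"
    by blast
  have aF: "a \<subseteq> Field lam"
    using a(2) by (auto simp: closure_points_def)
  define x where "x = str a c0"
  have "x \<in> M"
  proof -
    obtain u where u: "u \<in> Field lam" "a \<subseteq> underS lam u" "e0 \<in> underS lam u"
      by (rule l.small_bounded_above[OF aF a(4) e0])
    have "a \<in> B u" "a \<subseteq> under lam u"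
      using u a(1) unfolding B_def by (auto simp: under_def underS_def)
    then have "x \<in> N u"
      unfolding N_def x_def using c0D by blast
    then show ?thesis
      unfolding M_def using u(1) by blast
  qed
  have Mlt_sub: "?Mlt b \<subseteq> M" for b
    unfolding M_def using underS_imp_Field(1)[of _ lam b] by blast
  have Mlt_str: "?Mlt b \<subseteq> {str c d | c d. c \<subseteq> underS lam b \<and> d \<in> D}" for b
  proof
    fix y assume "y \<in> ?Mlt b"
    then obtain e where e: "e \<in> underS lam b" "y \<in> N e"
      by blast
    obtain c d where y: "y = str c d" "c \<subseteq> under lam e" "d \<in> D"
      using N_sub e(2) by blast
    have "c \<subseteq> underS lam b"
      using y(2) le_underS_trans[OF l.wo _ e(1)] by (auto simp: under_def)
    then show "y \<in> {str c d | c d. c \<subseteq> underS lam b \<and> d \<in> D}"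
      using y by blast
  qed
  have Mlt_in: "str (a \<inter> under lam c) d \<in> ?Mlt b"
    if c: "c \<in> a" and b: "b \<in> a" and cb: "c \<in> underS lam b" and d: "d \<in> D" for b c d
  proof -
    obtain e where e: "e \<in> underS lam b" "a \<inter> underS lam c \<in> BB e"
      using approach[OF c b cb] by blast
    obtain e' where e': "e' \<in> underS lam b" "e \<in> under lam e'" "c \<in> under lam e'"
      using underS_directed[OF l.wo e(1) cb] by blast
    have eq: "a \<inter> under lam c = insert c (a \<inter> underS lam c)"
      using c aF l.under_eq[of c] by auto
    have "a \<inter> under lam c \<in> B e'"
      unfolding B_def eq using e(2) e'(2,3) by (intro UnI2 image_eqI[of _ _ "(c, a \<inter> underS lam c)"]) auto
    moreover have "a \<inter> under lam c \<subseteq> under lam e'"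
      using e'(3) le_trans_rel[OF l.wo] by (auto simp: under_def)
    ultimately have "str (a \<inter> under lam c) d \<in> N e'"
      unfolding N_def using d by blast
    then show ?thesis
      using e'(1) by blast
  qed
  have bit: "(\<exists>w\<in>?Alt \<gamma>. near r (?Alt \<beta>) w (f x)) \<longleftrightarrow> j \<in> X"
    if c: "consecutive lam a \<alpha> \<beta>" "consecutive lam a \<beta> \<gamma>" and j: "position lam \<kappa> a \<alpha> j" for \<alpha> \<beta> \<gamma> j
  proof -
    have b: "\<beta> \<in> a" "\<gamma> \<in> a" "\<beta> \<in> underS lam \<gamma>"
      using c by (auto simp: consecutive_def)
    have "(\<exists>y\<in>?Mlt \<gamma>. near L (?Mlt \<beta>) y x) \<longleftrightarrow> j \<in> X"
      unfolding L_def x_def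
      by (rule coded_bit[OF lexM aF a(3) c j \<open>x \<in> M\<close>[unfolded x_def] Mlt_sub Mlt_sub Mlt_str Mlt_str])
        (rule Mlt_in; (assumption | rule b))+
    then show ?thesis
      using bits[OF subsetD[OF a(2) b(1)] subsetD[OF a(2) b(2)] b(3) \<open>x \<in> M\<close>] by simp
  qed
  have "X = read_bits lam \<kappa> A r h a (f x)"
  proof
    show "read_bits lam \<kappa> A r h a (f x) \<subseteq> X"
      unfolding read_bits_def using bit by blast
    show "X \<subseteq> read_bits lam \<kappa> A r h a (f x)"
    proof
      fix j assume jX: "j \<in> X"
      then have jF: "j \<in> Field \<kappa>"
        using X by blast
      obtain j1 where j1: "j1 \<in> Field \<kappa>" "j \<in> underS \<kappa> j1"
        using limit[OF jF] by blast
      obtain j2 where j2: "j2 \<in> Field \<kappa>" "j1 \<in> underS \<kappa> j2"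
        using limit[OF j1(1)] by blast
      obtain \<alpha> where \<alpha>: "position lam \<kappa> a \<alpha> j"
        by (rule all_positions[OF aF a(3) jF])
      obtain u where u: "position lam \<kappa> a u j1"
        by (rule all_positions[OF aF a(3) j1(1)])
      obtain v where v: "position lam \<kappa> a v j2"
        by (rule all_positions[OF aF a(3) j2(1)])
      have auv: "\<alpha> \<in> a" "u \<in> a" "v \<in> a" "\<alpha> \<in> underS lam u" "u \<in> underS lam v"
        using \<alpha> u v j1(2) j2(2) position_less_iff[OF aF \<alpha> u] position_less_iff[OF aF u v]
        by (auto simp: position_def)
      obtain \<beta> where \<beta>: "consecutive lam a \<alpha> \<beta>"
        by (rule consecutive_exists[OF aF auv(1,2,4)])
      then have "(\<beta>, u) \<in> lam" and \<beta>a: "\<beta> \<in> a"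
        using auv(2,4) by (auto simp: consecutive_def)
      then have "\<beta> \<in> underS lam v"
        using le_underS_trans[OF l.wo _ auv(5)] by blast
      then obtain \<gamma> where \<gamma>: "consecutive lam a \<beta> \<gamma>"
        by (rule consecutive_exists[OF aF \<beta>a auv(3)])
      show "j \<in> read_bits lam \<kappa> A r h a (f x)"
        unfolding read_bits_def using bit[OF \<beta> \<gamma> \<alpha>] jX \<alpha> \<beta> \<gamma> by blast
    qed
  qed
  moreover have "a \<in> BA"
    unfolding BA_def using a(1) e0 by blast
  moreover have "f x \<in> A"
    using f \<open>x \<in> M\<close> by (auto simp: order_embedding_on_def)
  ultimately show False
    using X_new by blast
qed

end
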